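(* Let $\mathscr{K}$ be a real closed field equipped with a nontrivial and convex valuation $\mathrm{val}:\mathscr{K}\to\Gamma\cup\{-\infty\}$. Suppose that the set $\mathscr{S}\subset\mathscr{K}^n$ is semialgebraic. Then every stratum of $\mathrm{val}(\mathscr{S})$ is closed in the product topology of the order topology of the value group $\Gamma$. Furthermore, if $\mathscr{S}$ is closed, then $\mathrm{val}(\mathscr{S})$ is closed in the product topology of the order topology of $\Gamma\cup\{-\infty\}$.
   Context: Max-convention for valuations: $\Gamma$ is an ordered abelian group and $\mathrm{val}:\mathscr{K}\to\Gamma\cup\{-\infty\}$ is surjective with $\mathrm{val}(x)=-\infty\iff x=0$, $\mathrm{val}(xy)=\mathrm{val}(x)+\mathrm{val}(y)$, $\mathrm{val}(x+y)\le\max(\mathrm{val}(x),\mathrm{val}(y))$; here $-\infty$ is the least element. It is nontrivial if $\Gamma\neq\{0\}$. With $\mathscr{O}=\{x:\mathrm{val}(x)\le0\}$, it is convex (with respect to the unique order of the real closed field $\mathscr{K}$) if $x_1\in\mathscr{O}$, $x_2\in\mathscr{K}$ and $0\le x_2\le x_1$ imply $x_2\in\mathscr{O}$. $\mathrm{val}$ is applied coordinatewise to points of $\mathscr{K}^n$. A set $\mathscr{S}\subset\mathscr{K}^n$ is semialgebraic if it is a finite union of sets of the form $\{x\in\mathscr{K}^n: P_1(x)>0,\dots,P_p(x)>0,\,P_{p+1}(x)=\dots=P_q(x)=0\}$ with $P_i\in\mathscr{K}[X_1,\dots,X_n]$. "Closed" for $\mathscr{S}$ refers to the product of the order topology of $\mathscr{K}$.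 The support of $x\in(\Gamma\cup\{-\infty\})^n$ is $\{k:x_k\ne-\infty\}$. For nonempty $K\subset\{1,\dots,n\}$, the stratum of $S\subset(\Gamma\cup\{-\infty\})^n$ associated with $K$ is the set of $(x_k)_{k\in K}\in\Gamma^K$ for $x\in S$ with support exactly $K$. *)

theory Defs
  imports "HOL-Analysis.Analysis" "HOL-Library.Option_ord" "HOL-Library.Poly_Mapping"
    "HOL-Computational_Algebra.Polynomial"
begin

text \<open>
  Real closed fields: ordered fields in which every nonnegative element is a square and every
  polynomial of odd degree has a root.  Polynomials are spelled out by their coefficients, as in
  \<^class>\<open>alg_closed_field\<close>; the version for \<^typ>\<open>'a poly\<close> follows below.
\<close>

class real_closed_field = linordered_field +
  assumes nonneg_is_square: "0 \<le> a \<Longrightarrow> \<exists>b. a = b * b"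
    and odd_has_root: "odd d \<Longrightarrow> c d \<noteq> 0 \<Longrightarrow> \<exists>x. (\<Sum>k\<le>d. c k * x ^ k) = 0"

lemma odd_degree_has_root:
  fixes p :: "'a::real_closed_field poly"
  assumes "odd (degree p)"
  shows "\<exists>x. poly p x = 0"
proof -
  have "coeff p (degree p) \<noteq> 0"
    using assms by (cases "p = 0") auto
  from odd_has_root[of "degree p" "coeff p", OF assms this] show ?thesis
    by (simp add: poly_altdef)
qed

text \<open>
  \<open>\<Gamma> \<union> {-\<infinity>}\<close> is \<^typ>\<open>'g option\<close>, where \<^term>\<open>None\<close> is \<open>-\<infinity>\<close>: it is the least element for the
  order of \<open>HOL-Library.Option_ord\<close> and, below, absorbing for addition.  The topology is the order
  topology.
\<close>

instantiation option :: (plus) plus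
begin

definition plus_option :: "'a option \<Rightarrow> 'a option \<Rightarrow> 'a option" where
  "plus_option a b = (case (a, b) of (Some x, Some y) \<Rightarrow> Some (x + y) | _ \<Rightarrow> None)"

instance ..

end

instantiation option :: (linorder) linorder_topology
begin

definition open_option :: "'a option set \<Rightarrow> bool" where
  "open_option = generate_topology (range (\<lambda>a. {..<a}) \<union> range (\<lambda>a. {a<..}))"

instance
  by standard (rule open_option_def)

end

definition valuation :: "('k::field \<Rightarrow> 'g::linordered_ab_group_add option) \<Rightarrow> bool" where
  "valuation v \<longleftrightarrow>
     surj v \<and>
     (\<forall>x. v x = None \<longleftrightarrow> x = 0) \<and>
     (\<forall>x y. v (x * y) = v x + v y) \<and>
     (\<forall>x y. v (x + y) \<le> max (v x) (v y))"

definition nontrivial_valuation :: "('k::field \<Rightarrow> 'g::linordered_ab_group_add option) \<Rightarrow> bool" where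
  "nontrivial_valuation v \<longleftrightarrow> valuation v \<and> (UNIV :: 'g set) \<noteq> {0}"

definition valuation_ring :: "('k::field \<Rightarrow> 'g::linordered_ab_group_add option) \<Rightarrow> 'k set" where
  "valuation_ring v = {x. v x \<le> Some 0}"

definition convex_valuation ::
    "('k::linordered_field \<Rightarrow> 'g::linordered_ab_group_add option) \<Rightarrow> bool" where
  "convex_valuation v \<longleftrightarrow>
     valuation v \<and>
     (\<forall>x1 \<in> valuation_ring v. \<forall>x2. 0 \<le> x2 \<and> x2 \<le> x1 \<longrightarrow> x2 \<in> valuation_ring v)"

text \<open>
  For an index set \<open>K\<close>, the set \<open>A\<^sup>K\<close> is rendered as \<^term>\<open>K \<rightarrow>\<^sub>E (UNIV :: 'a set)\<close>, the functions on
  \<^typ>\<open>nat\<close> that are \<^const>\<open>undefined\<close> outside \<open>K\<close>; this is the carrier of the product topology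
  below.  In particular \<open>A\<^sup>n\<close> is the case \<^term>\<open>K = {1..n::nat}\<close>.
\<close>

abbreviation cart_power :: "nat set \<Rightarrow> (nat \<Rightarrow> 'a) set" where
  "cart_power K \<equiv> K \<rightarrow>\<^sub>E UNIV"

abbreviation power_topology :: "nat set \<Rightarrow> (nat \<Rightarrow> 'a::topological_space) topology" where
  "power_topology K \<equiv> product_topology (\<lambda>_. euclidean) K"

text \<open>
  Polynomials in the indeterminates \<open>X\<^sub>i\<close>, \<open>i :: nat\<close>: finitely supported maps from exponent vectors
  to coefficients.
\<close>

type_synonym 'a mpolynomial = "(nat \<Rightarrow>\<^sub>0 nat) \<Rightarrow>\<^sub>0 'a"

definition mpolynomials :: "nat \<Rightarrow> 'a::zero mpolynomial set" where
  "mpolynomials n = {P. \<forall>m \<in> Poly_Mapping.keys P. Poly_Mapping.keys m \<subseteq> {1..n}}"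

definition mpeval :: "'a::comm_semiring_1 mpolynomial \<Rightarrow> (nat \<Rightarrow> 'a) \<Rightarrow> 'a" where
  "mpeval P x = (\<Sum>m\<in>Poly_Mapping.keys P. Poly_Mapping.lookup P m * (\<Prod>i\<in>Poly_Mapping.keys m. x i ^ Poly_Mapping.lookup m i))"

definition basic_semialgebraic :: "nat \<Rightarrow> (nat \<Rightarrow> 'k::linordered_field) set \<Rightarrow> bool" where
  "basic_semialgebraic n B \<longleftrightarrow>
     (\<exists>(P :: nat \<Rightarrow> 'k mpolynomial) p q.
        p \<le> q \<and> (\<forall>i\<in>{1..q}. P i \<in> mpolynomials n) \<and>
        B = {x \<in> cart_power {1..n}.
               (\<forall>i\<in>{1..p}. mpeval (P i) x > 0) \<and> (\<forall>i\<in>{p+1..q}. mpeval (P i) x = 0)})"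

definition semialgebraic :: "nat \<Rightarrow> (nat \<Rightarrow> 'k::linordered_field) set \<Rightarrow> bool" where
  "semialgebraic n S \<longleftrightarrow> (\<exists>\<B>. finite \<B> \<and> (\<forall>B\<in>\<B>. basic_semialgebraic n B) \<and> S = \<Union>\<B>)"

definition val_image :: "nat \<Rightarrow> ('k \<Rightarrow> 'g option) \<Rightarrow> (nat \<Rightarrow> 'k) set \<Rightarrow> (nat \<Rightarrow> 'g option) set" where
  "val_image n v S = (\<lambda>x. \<lambda>k\<in>{1..n}. v (x k)) ` S"

definition support :: "nat \<Rightarrow> (nat \<Rightarrow> 'g option) \<Rightarrow> nat set" where
  "support n y = {k \<in> {1..n}. y k \<noteq> None}"

definition stratum :: "nat \<Rightarrow> (nat \<Rightarrow> 'g option) set \<Rightarrow> nat set \<Rightarrow> (nat \<Rightarrow> 'g) set" where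
  "stratum n T K = (\<lambda>y. \<lambda>k\<in>K. the (y k)) ` {y \<in> T. support n y = K}"

end

theory Submission
  imports "HOL-Algebra.Algebraic_Closure_Type" Defs
begin

text \<open>
  Let \<open>\<gamma>\<close> lie in the closure of a stratum of \<open>val(S)\<close>, or of \<open>val(S)\<close> itself, let \<open>K\<close> be the set
  of coordinates with \<open>\<gamma>\<^sub>k \<noteq> -\<infinity>\<close>, and choose \<open>c\<^sub>k > 0\<close> with \<open>val(c\<^sub>k) = \<gamma>\<^sub>k\<close> for \<open>k \<in> K\<close>. For
  \<open>s > 0\<close> in the field consider the condition that \<open>S\<close> contains points with
  \<open>c\<^sub>k / s \<le> |x\<^sub>k| \<le> s c\<^sub>k\<close> for \<open>k \<in> K\<close>, whose other coordinates are zero (for a stratum) or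
  arbitrarily small (for \<open>val(S)\<close>). Since the valuation is convex, it is monotone in the
  absolute value; so \<open>\<gamma>\<close> being in the closure gives the condition for every \<open>s\<close> with
  \<open>val(s) > 0\<close>, whereas any \<open>s\<close> with \<open>val(s) \<le> 0\<close> that satisfies it forces \<open>val(x\<^sub>k) = \<gamma>\<^sub>k\<close>. The
  point is to pass from the former \<open>s\<close> to one of the latter (\<open>definable_meets_valuation_ring\<close>).

  The condition on \<open>s\<close> is a formula in the language of ordered fields. By Tarski--Seidenberg it
  defines a finite union of intervals with endpoints in the field, so if it failed for all
  \<open>s > 0\<close> with \<open>val(s) \<le> 0\<close>, the set of these \<open>s\<close> would be definable and have a supremum. It has
  none: adding \<open>1\<close> does not leave it, and halving does not leave the set of \<open>s\<close> with
  \<open>val(s) > 0\<close>. For \<open>val(S)\<close> one more step is required, because an admissible \<open>s\<close> only yields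
  points whose coordinates outside \<open>K\<close> are as small as desired. These points are bounded, and
  suprema of definable sets provide a cluster point of them (\<open>cluster_point\<close>); it belongs to \<open>S\<close>
  because \<open>S\<close> is closed.

  What remains is quantifier elimination for real closed fields, which is treated semantically.
  A predicate on points is called definable if its truth value depends only on the signs of
  finitely many polynomial functions. Closure under Boolean operations is then immediate, and
  closure under \<open>\<exists>\<close> (\<open>definable_exists\<close>) says that the signs of finitely many functions of the
  coefficients determine which sign vectors a family of univariate polynomials attains. This is
  the algorithm of Cohen and Hoermander, read as an induction on degrees: the pattern of signs
  of a family along the line is determined by the pattern of the family in which a polynomial
  \<open>p\<close> of largest degree is replaced by its derivative and its remainders modulo the derivative
  and the other members (\<open>same_pattern_insert\<close>). Indeed, the remainders give the sign of \<open>p\<close> at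
  the roots of the smaller family, and between such roots \<open>p\<close> is strictly monotone.

  The induction rests on the intermediate value theorem for polynomials, which is deduced from
  the axioms of a real closed field \<open>K\<close> by Laplace's argument: every nonconstant polynomial over
  \<open>K\<close> has a root in \<open>K(i)\<close> (\<open>root_in_adjoin\<close>), by induction on the exponent of \<open>2\<close> in its
  degree.
\<close>

hide_const (open) Polynomials.degree Polynomials.lead_coeff UnivPoly.coeff UnivPoly.monom

section \<open>The intermediate value theorem for polynomials\<close>

lemma map_poly_to_ac_add: "map_poly to_ac (p + q) = map_poly to_ac p + map_poly to_ac q"
  by (rule poly_eqI) (simp add: coeff_map_poly)

lemma map_poly_to_ac_mult: "map_poly to_ac (p * q) = map_poly to_ac p * map_poly to_ac q"
  by (rule poly_eqI) (simp add: coeff_map_poly coeff_mult to_ac_sum)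

lemma poly_map_poly_to_ac: "poly (map_poly to_ac p) (to_ac x) = to_ac (poly p x)"
  by (induction p) (simp_all add: map_poly_pCons)

lemma degree_map_poly_to_ac: "degree (map_poly to_ac p) = degree p"
  by (rule degree_map_poly) simp

lemma factorization_over_alg_closure:
  fixes p :: "'a::field poly"
  assumes "p \<noteq> 0"
  obtains x where "map_poly to_ac p = smult (to_ac (lead_coeff p)) (\<Prod>i<degree p. [:- x i, 1:])"
proof -
  have "map_poly to_ac p \<noteq> 0" using assms by (simp add: map_poly_eq_0_iff)
  then obtain A where A: "size A = degree (map_poly to_ac p)"
    "map_poly to_ac p = smult (lead_coeff (map_poly to_ac p)) (\<Prod>x\<in>#A. [:-x, 1:])"
    using alg_closed_imp_factorization by blast
  obtain xs where xs: "mset xs = A" using ex_mset by blast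
  have "(\<Prod>x\<in>#A. [:-x, 1:]) = prod_list (map (\<lambda>x. [:-x, 1:]) xs)"
    by (simp flip: xs prod_mset_prod_list)
  also have "\<dots> = (\<Prod>i<length xs. [:- xs ! i, 1:])"
    by (simp add: prod.list_conv_set_nth atLeast0LessThan)
  finally show ?thesis
    using A xs that[of "\<lambda>i. xs ! i"] by (simp add: degree_map_poly_to_ac coeff_map_poly flip: size_mset)
qed

text \<open>
  The product is the resultant of \<open>p\<close> and \<open>q\<close> up to a power of the leading coefficient. It can
  be computed in the base field by Euclid's algorithm: reducing \<open>q\<close> modulo \<open>p\<close> does not change
  the values at the roots of \<open>p\<close>, and exchanging the two polynomials changes the product only by
  a factor from the base field, since both products are made of the differences of the roots.
\<close>

lemma prod_over_roots_in_base_field: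
  fixes p q :: "'a::field poly" and x :: "nat \<Rightarrow> 'a alg_closure"
  assumes "map_poly to_ac p = smult c (\<Prod>i<n. [:- x i, 1:])" "c \<noteq> 0"
  shows "(\<Prod>i<n. poly (map_poly to_ac q) (x i)) \<in> range to_ac"
  using assms
proof (induction "degree p" arbitrary: p q c n x rule: less_induct)
  case less
  have "degree (map_poly to_ac p) = n"
    using less.prems by (simp add: degree_prod_eq_sum_degree)
  hence n: "degree p = n" by (simp add: degree_map_poly_to_ac)
  have p0: "p \<noteq> 0" using less.prems by (auto simp: map_poly_eq_0_iff)
  have root: "poly (map_poly to_ac p) (x i) = 0" if "i < n" for i
    using less.prems that by (auto simp: poly_prod prod_zero_iff)
  define r where "r = q mod p"
  have "q = (q div p) * p + r" by (simp add: r_def)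
  hence "map_poly to_ac q = map_poly to_ac (q div p) * map_poly to_ac p + map_poly to_ac r"
    by (metis map_poly_to_ac_add map_poly_to_ac_mult)
  hence qr: "poly (map_poly to_ac q) (x i) = poly (map_poly to_ac r) (x i)" if "i < n" for i
    using root that by simp
  hence eq: "(\<Prod>i<n. poly (map_poly to_ac q) (x i)) = (\<Prod>i<n. poly (map_poly to_ac r) (x i))"
    by simp
  show ?case
  proof (cases "r = 0")
    case True
    have "(\<Prod>i<n. poly (map_poly to_ac r) (x i)) = (if n = 0 then 1 else 0)"
      using True by simp
    also have "\<dots> = to_ac (if n = 0 then 1 else 0)" by simp
    finally show ?thesis using eq by (metis rangeI)
  next
    case False
    hence dr: "degree r < degree p"
      unfolding r_def using p0 by (metis degree_mod_less')
    obtain y where y: "map_poly to_ac r = smult (to_ac (lead_coeff r)) (\<Prod>i<degree r. [:- y i, 1:])"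
      using factorization_over_alg_closure[OF False] .
    have ih: "(\<Prod>j<degree r. poly (map_poly to_ac p) (y j)) \<in> range to_ac"
      using less.hyps[OF dr y] False by simp
    have c: "c = to_ac (lead_coeff p)"
    proof -
      have "lead_coeff (map_poly to_ac p) = c"
        using less.prems by (simp add: lead_coeff_prod)
      thus ?thesis by (simp add: degree_map_poly_to_ac coeff_map_poly)
    qed
    define N where "N = degree r"
    have "(\<Prod>i<n. poly (map_poly to_ac r) (x i)) = to_ac (lead_coeff r) ^ n * (\<Prod>i<n. \<Prod>j<N. x i - y j)"
      by (simp add: y poly_prod prod.distrib N_def)
    also have "(\<Prod>i<n. \<Prod>j<N. x i - y j) = (\<Prod>j<N. \<Prod>i<n. (-1) * (y j - x i))"
      by (subst prod.swap) simp
    also have "\<dots> = ((-1)^n)^N * (\<Prod>j<N. \<Prod>i<n. y j - x i)"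
      by (simp only: prod.distrib prod_constant card_lessThan)
    also have "(\<Prod>j<N. \<Prod>i<n. y j - x i) = (\<Prod>j<N. poly (map_poly to_ac p) (y j)) / c ^ N"
      using less.prems by (simp add: poly_prod prod.distrib)
    finally have "(\<Prod>i<n. poly (map_poly to_ac r) (x i)) =
      to_ac (lead_coeff r) ^ n * (((-1)^n)^N * ((\<Prod>j<N. poly (map_poly to_ac p) (y j)) / c ^ N))" .
    moreover obtain w where "(\<Prod>j<N. poly (map_poly to_ac p) (y j)) = to_ac w" using ih N_def by blast
    ultimately have "(\<Prod>i<n. poly (map_poly to_ac r) (x i)) = to_ac (lead_coeff r ^ n * (((-1)^n)^N * (w / lead_coeff p ^ N)))"
      by (simp add: c)
    thus ?thesis using eq by (metis rangeI)
  qed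
qed

text \<open>
  Interpolation, one value at a time: \<open>H - H(y\<^sub>0)\<close> is divisible by \<open>X - y\<^sub>0\<close>, and the quotient
  again takes values in the base field outside \<open>T \<union> {y\<^sub>0}\<close>. Allowing finitely many exceptions
  \<open>T\<close> makes this induction work, and later makes it possible to divide by a polynomial.
\<close>

lemma polynomial_with_values_in_base_field:
  fixes H :: "'a::field_char_0 alg_closure poly"
  assumes "finite T" "\<And>y. y \<notin> T \<Longrightarrow> poly H (to_ac y) \<in> range to_ac"
  shows "H \<in> range (map_poly to_ac)"
  using assms
proof (induction "degree H" arbitrary: H T rule: less_induct)
  case less
  obtain y0 where y0: "y0 \<notin> T" using less.prems(1) ex_new_if_finite infinite_UNIV_char_0 by blast
  then obtain h0 where h0: "poly H (to_ac y0) = to_ac h0" using less.prems(2) by blast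
  show ?case
  proof (cases "degree H = 0")
    case True
    then obtain c where "H = [:c:]" by (metis degree_eq_zeroE)
    hence "H = map_poly to_ac [:h0:]" using h0 by (simp add: map_poly_pCons)
    thus ?thesis by blast
  next
    case False
    have "poly (H - [:to_ac h0:]) (to_ac y0) = 0" using h0 by simp
    then obtain G where G: "H - [:to_ac h0:] = [:- to_ac y0, 1:] * G"
      by (metis dvd_def poly_eq_0_iff_dvd)
    have HG: "H = [:to_ac h0:] + [:- to_ac y0, 1:] * G" using G by (simp add: algebra_simps)
    have "G \<noteq> 0" using HG False by auto
    have "degree ([:- to_ac y0, 1:] * G) = Suc (degree G)"
      using \<open>G \<noteq> 0\<close> by (subst degree_mult_eq) auto
    hence "degree H = Suc (degree G)" unfolding HG by (subst degree_add_eq_right) auto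
    hence dG: "degree G < degree H" by simp
    have "poly G (to_ac y) \<in> range to_ac" if y: "y \<notin> insert y0 T" for y
    proof -
      obtain h where "poly H (to_ac y) = to_ac h" using less.prems(2)[of y] y by blast
      hence "to_ac h = to_ac h0 + (to_ac y - to_ac y0) * poly G (to_ac y)"
        using HG by (simp add: algebra_simps)
      hence "poly G (to_ac y) = (to_ac h - to_ac h0) / (to_ac y - to_ac y0)"
        using y by (simp add: field_simps)
      hence "poly G (to_ac y) = to_ac ((h - h0) / (y - y0))" by simp
      thus ?thesis by blast
    qed
    hence "G \<in> range (map_poly to_ac)" using less.hyps[OF dG, of "insert y0 T"] less.prems(1) by blast
    then obtain g where "G = map_poly to_ac g" by blast
    hence "H = map_poly to_ac ([:h0:] + [:- y0, 1:] * g)"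
      unfolding map_poly_to_ac_add map_poly_to_ac_mult using HG by (simp add: map_poly_pCons)
    thus ?thesis by blast
  qed
qed

text \<open>
  The coefficients of a square root are found from the top downwards: the coefficient of
  \<open>X\<^bsup>e+j\<^esup>\<close> in \<open>g\<^sup>2\<close>, where \<open>e = deg g\<close>, is twice that of \<open>X\<^sup>j\<close> in \<open>g\<close> plus products of higher
  ones.
\<close>

lemma monic_square_root_in_base_field:
  fixes g :: "'a::field_char_0 alg_closure poly"
  assumes "lead_coeff g = 1" "g * g \<in> range (map_poly to_ac)"
  shows "g \<in> range (map_poly to_ac)"
proof -
  define e where "e = degree g"
  obtain G where G: "g * g = map_poly to_ac G" using assms by blast
  have *: "k \<le> e \<Longrightarrow> coeff g (e - k) \<in> range to_ac" for k
  proof (induction k rule: less_induct)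
    case (less k)
    show ?case
    proof (cases "k = 0")
      case True
      thus ?thesis using assms by (metis e_def diff_zero rangeI to_ac_1)
    next
      case False
      define j where "j = e - k"
      have j: "j < e" "k = e - j" using False less.prems by (auto simp: j_def)
      have S: "coeff g l \<in> range to_ac" if "j < l" for l
      proof (cases "l \<le> e")
        case True
        thus ?thesis using less.IH[of "e - l"] that j by auto
      next
        case False
        hence "coeff g l = to_ac 0" using coeff_eq_0[of g] e_def by simp
        thus ?thesis by blast
      qed
      have "coeff (g * g) (e + j) = (\<Sum>i\<le>e+j. coeff g i * coeff g (e + j - i))"
        by (simp add: coeff_mult)
      also have "\<dots> = (\<Sum>i\<in>{j..e}. coeff g i * coeff g (e + j - i))"
      proof (rule sum.mono_neutral_right)
        show "\<forall>i\<in>{..e + j} - {j..e}. coeff g i * coeff g (e + j - i) = 0"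
        proof
          fix i assume "i \<in> {..e + j} - {j..e}"
          hence "i > e \<or> e + j - i > e" by auto
          thus "coeff g i * coeff g (e + j - i) = 0" using coeff_eq_0[of g] e_def by auto
        qed
      qed auto
      also have "{j..e} = insert j (insert e {j<..<e})" using j by auto
      also have "(\<Sum>i\<in>\<dots>. coeff g i * coeff g (e + j - i)) =
          2 * coeff g j + (\<Sum>i\<in>{j<..<e}. coeff g i * coeff g (e + j - i))"
        using j assms by (simp add: e_def)
      finally have eq: "to_ac (coeff G (e + j)) = 2 * coeff g j + (\<Sum>i\<in>{j<..<e}. coeff g i * coeff g (e + j - i))"
        by (simp add: G coeff_map_poly)
      obtain s where s: "\<And>l. j < l \<Longrightarrow> coeff g l = to_ac (s l)"
        using S unfolding image_iff by metis
      have "(\<Sum>i\<in>{j<..<e}. coeff g i * coeff g (e + j - i)) = to_ac (\<Sum>i\<in>{j<..<e}. s i * s (e + j - i))"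
        unfolding to_ac_sum by (rule sum.cong) (auto simp: s)
      hence "to_ac (coeff G (e + j)) = 2 * coeff g j + to_ac (\<Sum>i\<in>{j<..<e}. s i * s (e + j - i))"
        using eq by simp
      hence "coeff g j = to_ac ((coeff G (e + j) - (\<Sum>i\<in>{j<..<e}. s i * s (e + j - i))) / 2)"
        by (simp add: field_simps)
      hence "coeff g j \<in> range to_ac" by blast
      thus ?thesis unfolding j_def .
    qed
  qed
  have "coeff g l \<in> range to_ac" for l
  proof (cases "l \<le> e")
    case True
    thus ?thesis using *[of "e - l"] by auto
  next
    case False
    hence "coeff g l = to_ac 0" using coeff_eq_0[of g] e_def by simp
    thus ?thesis by blast
  qed
  hence "g = map_poly to_ac (map_poly of_ac g)"
    by (intro poly_eqI) (simp add: coeff_map_poly to_ac_of_ac)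
  thus ?thesis by blast
qed

lemma prod_square_symmetric:
  fixes F :: "nat \<Rightarrow> nat \<Rightarrow> 'b::comm_semiring_1"
  assumes "\<And>i j. F i j = F j i"
  shows "(\<Prod>i<d. \<Prod>j<d. F i j) = (\<Prod>i<d. F i i) * (\<Prod>j<d. \<Prod>i<j. F i j)^2"
proof (induction d)
  case (Suc d)
  have "(\<Prod>i<Suc d. \<Prod>j<Suc d. F i j) = (\<Prod>i<d. \<Prod>j<d. F i j) * (\<Prod>i<d. F i d) * ((\<Prod>j<d. F d j) * F d d)"
    by (simp add: prod.distrib mult_ac)
  also have "(\<Prod>j<d. F d j) = (\<Prod>i<d. F i d)" using assms by simp
  finally show ?case using Suc by (simp add: power2_eq_square algebra_simps)
qed simp

text \<open>
  The symmetric function argument in Laplace's proof. Taking the product over all ordered pairs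
  \<open>(i, j)\<close> instead of \<open>i < j\<close> gives a polynomial whose values are products over the roots of
  products over the roots, so that \<open>prod_over_roots_in_base_field\<close> applies twice. Ordered pairs
  count every \<open>i < j\<close> twice and add the diagonal; dividing by the diagonal and extracting a
  square root undoes this.
\<close>

lemma roots_of_pair_polynomial_over_base_field:
  fixes x :: "nat \<Rightarrow> 'a::field_char_0 alg_closure" and p :: "'a poly" and t :: 'a
  assumes p: "map_poly to_ac p = smult c (\<Prod>i<d. [:- x i, 1:])" "c \<noteq> 0"
  defines "h \<equiv> \<lambda>i j. x i + x j + to_ac t * (x i * x j)"
  shows "(\<Prod>j<d. \<Prod>i<j. [:- h i j, 1:]) \<in> range (map_poly to_ac)"
proof (rule monic_square_root_in_base_field)
  define g where "g = (\<Prod>j<d. \<Prod>i<j. [:- h i j, 1:])"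
  define D where "D = (\<Prod>i<d. [:- h i i, 1:])"
  show "lead_coeff (\<Prod>j<d. \<Prod>i<j. [:- h i j, 1:]) = 1"
    by (simp add: lead_coeff_prod)
  \<comment> \<open>The diagonal factor at \<open>z\<close> is a product over the roots of \<open>z - 2 X - t X\<^sup>2\<close>.\<close>
  have diag: "poly D (to_ac z) \<in> range to_ac" for z
  proof -
    have "poly D (to_ac z) = (\<Prod>i<d. poly (map_poly to_ac [:z, -2, -t:]) (x i))"
      by (simp add: D_def h_def poly_prod map_poly_pCons algebra_simps)
    thus ?thesis using prod_over_roots_in_base_field[OF p, of "[:z, -2, -t:]"] by simp
  qed
  have full: "poly (D * g^2) (to_ac z) \<in> range to_ac" for z
  proof -
    \<comment> \<open>\<open>H\<close> is the inner product as a polynomial in the other root; it has coefficients in the base field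
    because its values at elements of the base field are products over the roots of \<open>p\<close>.\<close>
    define H where "H = (\<Prod>j<d. [:to_ac z - x j, - (1 + to_ac t * x j):])"
    have "poly H (to_ac y) \<in> range to_ac" for y
    proof -
      have "poly H (to_ac y) = (\<Prod>j<d. poly (map_poly to_ac [:z - y, - (1 + t * y):]) (x j))"
        by (simp add: H_def poly_prod map_poly_pCons algebra_simps)
      thus ?thesis using prod_over_roots_in_base_field[OF p, of "[:z - y, - (1 + t * y):]"] by simp
    qed
    then obtain k where k: "H = map_poly to_ac k"
      using polynomial_with_values_in_base_field[of "{}" H] by blast
    have sq: "(\<Prod>i<d. \<Prod>j<d. [:- h i j, 1:]) = D * g^2"
      unfolding D_def g_def
      by (subst prod_square_symmetric) (simp_all add: h_def add_ac mult_ac prod_power_distrib)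
    have "poly (D * g^2) (to_ac z) = (\<Prod>i<d. poly H (x i))"
      unfolding sq[symmetric] by (simp add: H_def h_def poly_prod algebra_simps)
    thus ?thesis using prod_over_roots_in_base_field[OF p, of k] k by simp
  qed
  have "D \<noteq> 0" by (auto simp: D_def)
  hence "finite {u. poly D u = 0}" by (rule poly_roots_finite)
  hence fin: "finite {z. poly D (to_ac z) = 0}"
    using finite_vimageI[OF _ inj_to_ac, of "{u. poly D u = 0}"] by (simp add: vimage_def)
  have "poly (g * g) (to_ac z) \<in> range to_ac" if "z \<notin> {z. poly D (to_ac z) = 0}" for z
  proof -
    obtain a b where ab: "poly D (to_ac z) = to_ac a" "poly (D * g^2) (to_ac z) = to_ac b"
      using diag full by blast
    have "poly (g * g) (to_ac z) = poly (D * g^2) (to_ac z) / poly D (to_ac z)"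
      using that by (simp add: power2_eq_square)
    hence "poly (g * g) (to_ac z) = to_ac (b / a)" unfolding ab by simp
    thus ?thesis by blast
  qed
  thus "(\<Prod>j<d. \<Prod>i<j. [:- h i j, 1:]) * (\<Prod>j<d. \<Prod>i<j. [:- h i j, 1:]) \<in> range (map_poly to_ac)"
    using polynomial_with_values_in_base_field[OF fin] unfolding g_def by blast
qed

text \<open>
  For \<open>w\<^sup>2 = -1\<close> this is the field \<open>K(i)\<close>.
\<close>

definition adjoin :: "'a::field alg_closure \<Rightarrow> 'a alg_closure set" where
  "adjoin w = {to_ac a + to_ac b * w | a b. True}"

lemma adjoinI: "z = to_ac a + to_ac b * w \<Longrightarrow> z \<in> adjoin w"
  unfolding adjoin_def by blast

lemma
  fixes w :: "'a::real_closed_field alg_closure"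
  assumes w: "w * w = -1"
  shows adjoin_add: "y \<in> adjoin w \<Longrightarrow> z \<in> adjoin w \<Longrightarrow> y + z \<in> adjoin w"
    and adjoin_mult: "y \<in> adjoin w \<Longrightarrow> z \<in> adjoin w \<Longrightarrow> y * z \<in> adjoin w"
    and to_ac_in_adjoin: "to_ac a \<in> adjoin w"
    and square_root_in_adjoin: "y * y \<in> adjoin w \<Longrightarrow> y \<in> adjoin w"
proof -
  show add: "y + z \<in> adjoin w" if yz: "y \<in> adjoin w" "z \<in> adjoin w" for y z
  proof -
    obtain a b c d where "y = to_ac a + to_ac b * w" "z = to_ac c + to_ac d * w"
      using yz unfolding adjoin_def by blast
    thus ?thesis by (intro adjoinI[of _ "a + c" "b + d"]) (simp add: algebra_simps)
  qed
  show mult: "y * z \<in> adjoin w" if yz: "y \<in> adjoin w" "z \<in> adjoin w" for y z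
  proof -
    obtain a b c d where "y = to_ac a + to_ac b * w" "z = to_ac c + to_ac d * w"
      using yz unfolding adjoin_def by blast
    moreover have "to_ac b * w * (to_ac d * w) = - to_ac (b * d)"
      using w by (metis (no_types, lifting) ab_semigroup_mult_class.mult_ac(1) mult.left_commute mult_minus1_right to_ac_mult)
    ultimately show ?thesis
      by (intro adjoinI[of _ "a * c - b * d" "a * d + b * c"]) (simp add: algebra_simps)
  qed
  show base: "to_ac a \<in> adjoin w" for a
    by (rule adjoinI[of _ a 0]) simp
  show "y \<in> adjoin w" if y: "y * y \<in> adjoin w" for y
  proof -
    obtain u v where uv: "y * y = to_ac u + to_ac v * w" using y unfolding adjoin_def by blast
    have "0 \<le> u * u + v * v" by simp
    then obtain n' where n': "u * u + v * v = n' * n'" using nonneg_is_square by blast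
    \<comment> \<open>\<open>n\<close> is the absolute value of \<open>u + v i\<close>; the square root is \<open>a + b i\<close> with \<open>a\<^sup>2 = (n + u) / 2\<close>
    and \<open>b\<^sup>2 = (n - u) / 2\<close>, the sign of \<open>b\<close> being that of \<open>v\<close>.\<close>
    define n where "n = \<bar>n'\<bar>"
    have n: "n * n = u * u + v * v" "n \<ge> 0" using n' by (auto simp: n_def)
    have "\<bar>u\<bar> \<le> n" using n by (metis abs_le_square_iff abs_of_nonneg le_add_same_cancel1 power2_eq_square zero_le_square)
    hence "0 \<le> (n + u) / 2" "0 \<le> (n - u) / 2" by auto
    then obtain a' b' where ab': "(n + u) / 2 = a' * a'" "(n - u) / 2 = b' * b'"
      using nonneg_is_square by metis
    define a where "a = \<bar>a'\<bar>"
    define b where "b = (if v \<ge> 0 then \<bar>b'\<bar> else - \<bar>b'\<bar>)"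
    have ab: "a * a - b * b = u" using ab' by (auto simp: a_def b_def field_simps)
    have "(2 * (\<bar>a'\<bar> * \<bar>b'\<bar>))^2 = 4 * ((a' * a') * (b' * b'))"
      by (simp add: power_mult_distrib) (simp add: power2_eq_square)
    also have "\<dots> = \<bar>v\<bar>^2" using n by (simp flip: ab' add: field_simps power2_eq_square)
    finally have "2 * (\<bar>a'\<bar> * \<bar>b'\<bar>) = \<bar>v\<bar>" by (rule power2_eq_imp_eq) auto
    hence ab2: "2 * (a * b) = v" by (auto simp: a_def b_def)
    define r where "r = to_ac a + to_ac b * w"
    have "to_ac b * w * (to_ac b * w) = - to_ac (b * b)"
      using w by (metis (no_types, lifting) ab_semigroup_mult_class.mult_ac(1) mult.left_commute mult_minus1_right to_ac_mult)
    hence "r * r = to_ac (a * a - b * b) + to_ac (2 * (a * b)) * w"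
      by (simp add: r_def algebra_simps)
    also have "\<dots> = y * y" by (simp only: ab ab2 uv)
    finally have "y = r \<or> y = - r" by (metis square_eq_iff)
    thus ?thesis
    proof
      assume "y = r" thus ?thesis unfolding r_def by (rule adjoinI)
    next
      assume "y = - r" thus ?thesis unfolding r_def by (intro adjoinI[of _ "-a" "-b"]) simp
    qed
  qed
qed

text \<open>
  Laplace's induction. The polynomial with roots \<open>x\<^sub>i + x\<^sub>j + t x\<^sub>i x\<^sub>j\<close> for \<open>i < j\<close> has degree
  \<open>d (d - 1) / 2\<close>, which has one factor \<open>2\<close> less than \<open>d\<close>, so one of these elements lies in
  \<open>K(i)\<close>. There are infinitely many \<open>t\<close> but finitely many pairs; two values of \<open>t\<close> with the same
  pair put \<open>x\<^sub>i + x\<^sub>j\<close> and \<open>x\<^sub>i x\<^sub>j\<close> into \<open>K(i)\<close>, and \<open>K(i)\<close> is closed under square roots.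
\<close>

lemma root_in_adjoin:
  fixes w :: "'a::real_closed_field alg_closure" and p :: "'a poly"
  assumes w: "w * w = -1" and "degree p = 2 ^ k * m" "odd m"
  shows "\<exists>\<alpha>\<in>adjoin w. poly (map_poly to_ac p) \<alpha> = 0"
  using assms(2,3)
proof (induction k arbitrary: p m)
  case 0
  then obtain r where "poly p r = 0" using odd_degree_has_root[of p] by auto
  hence "poly (map_poly to_ac p) (to_ac r) = 0" by (simp add: poly_map_poly_to_ac)
  thus ?case using to_ac_in_adjoin[OF w] by blast
next
  case (Suc k)
  define d where "d = degree p"
  have "p \<noteq> 0" using Suc.prems by (auto elim: oddE)
  then obtain x where x: "map_poly to_ac p = smult (to_ac (lead_coeff p)) (\<Prod>i<d. [:- x i, 1:])"
    using factorization_over_alg_closure d_def by blast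
  define h where "h = (\<lambda>t i j. x i + x j + to_ac t * (x i * x j))"
  have "\<exists>j<d. \<exists>i<j. h t i j \<in> adjoin w" for t
  proof -
    obtain g where g: "(\<Prod>j<d. \<Prod>i<j. [:- h t i j, 1:]) = map_poly to_ac g"
      using roots_of_pair_polynomial_over_base_field[OF x, of t] \<open>p \<noteq> 0\<close> by (auto simp: h_def)
    have "degree g = degree (\<Prod>j<d. \<Prod>i<j. [:- h t i j, 1:])" by (simp add: g degree_map_poly_to_ac)
    also have "\<dots> = (\<Sum>j<d. j)" by (simp add: degree_prod_eq_sum_degree)
    also have "\<dots> = d * (d - 1) div 2"
      using gauss_sum_nat[of "d - 1"] by (cases d) (simp_all add: lessThan_Suc_atMost atMost_atLeast0 mult.commute)
    also have "\<dots> = 2 ^ k * (m * (d - 1))" using Suc.prems by (simp add: d_def)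
    finally have "degree g = 2 ^ k * (m * (d - 1))" .
    moreover have "odd (m * (d - 1))" using Suc.prems by (auto simp: d_def elim: oddE)
    ultimately obtain \<alpha> where "\<alpha> \<in> adjoin w" "poly (map_poly to_ac g) \<alpha> = 0"
      using Suc.IH by blast
    thus ?thesis by (auto simp flip: g simp: poly_prod prod_zero_iff)
  qed
  hence "\<exists>ij. snd ij < d \<and> fst ij < snd ij \<and> h t (fst ij) (snd ij) \<in> adjoin w" for t
    by (metis fst_conv snd_conv)
  then obtain f where f: "\<And>t. snd (f t) < d \<and> fst (f t) < snd (f t) \<and> h t (fst (f t)) (snd (f t)) \<in> adjoin w"
    by metis
  have "range f \<subseteq> {..<d} \<times> {..<d}"
  proof
    fix z assume "z \<in> range f"
    then obtain t where "z = f t" by blast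
    thus "z \<in> {..<d} \<times> {..<d}" using f[of t] by (simp add: mem_Times_iff)
  qed
  hence "finite (range f)" by (rule finite_subset) simp
  hence "\<not> inj f" using infinite_UNIV_char_0 finite_imageD by blast
  then obtain s t where st: "s \<noteq> t" "f s = f t" by (auto simp: inj_def)
  obtain i j where ij: "f t = (i, j)" by force
  define P where "P = x i * x j"
  define Q where "Q = x i + x j"
  have 1: "Q + to_ac s * P \<in> adjoin w" "Q + to_ac t * P \<in> adjoin w"
    using f[of s] f[of t] st ij by (simp_all add: h_def P_def Q_def)
  have neg: "- y \<in> adjoin w" if "y \<in> adjoin w" for y
    using adjoin_mult[OF w that to_ac_in_adjoin[OF w, of "-1"]] by simp
  have "P = (Q + to_ac s * P + - (Q + to_ac t * P)) * to_ac (1 / (s - t))"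
    using st by (simp add: field_simps)
  hence P: "P \<in> adjoin w" using 1 neg adjoin_add[OF w] adjoin_mult[OF w] to_ac_in_adjoin[OF w] by metis
  have "Q = (Q + to_ac t * P) + - (to_ac t * P)" by simp
  hence Q: "Q \<in> adjoin w" using 1 P neg adjoin_add[OF w] adjoin_mult[OF w] to_ac_in_adjoin[OF w] by metis
  have "(x i - x j) * (x i - x j) = Q * Q + to_ac (-4) * P"
    by (simp add: P_def Q_def algebra_simps)
  hence "(x i - x j) * (x i - x j) \<in> adjoin w"
    using P Q adjoin_add[OF w] adjoin_mult[OF w] to_ac_in_adjoin[OF w] by metis
  hence "x i - x j \<in> adjoin w" by (rule square_root_in_adjoin[OF w])
  moreover have "x i = (Q + (x i - x j)) * to_ac (1 / 2)" by (simp add: Q_def)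
  ultimately have "x i \<in> adjoin w"
    using Q adjoin_add[OF w] adjoin_mult[OF w] to_ac_in_adjoin[OF w] by metis
  moreover have "i < d" using f[of t] ij by simp
  hence "poly (map_poly to_ac p) (x i) = 0" by (auto simp: x poly_prod prod_zero_iff)
  ultimately show ?case by blast
qed

text \<open>
  A root \<open>u + v i\<close> in \<open>K(i)\<close> provides a factor over \<open>K\<close>: either \<open>X - u\<close> with \<open>u\<close> outside the
  interval, or the polynomial \<open>(X - u)\<^sup>2 + v\<^sup>2\<close>, which is positive everywhere. Neither changes
  sign on the interval.
\<close>

lemma no_root_imp_same_sign:
  fixes p :: "'a::real_closed_field poly"
  assumes "a \<le> b" "\<And>x. a \<le> x \<Longrightarrow> x \<le> b \<Longrightarrow> poly p x \<noteq> 0"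
  shows "sgn (poly p a) = sgn (poly p b)"
  using assms(2)
proof (induction "degree p" arbitrary: p rule: less_induct)
  case less
  obtain w :: "'a alg_closure" where "w ^ 2 = -1" using nth_root_exists[of 2 "-1"] by auto
  hence w: "w * w = -1" by (simp add: power2_eq_square)
  show ?case
  proof (cases "degree p = 0")
    case True
    then obtain c where "p = [:c:]" by (metis degree_eq_zeroE)
    thus ?thesis by simp
  next
    case False
    then obtain k m where "degree p = 2 ^ k * m" "odd m"
      by (metis multiplicity_decompose' One_nat_def nat_dvd_1_iff_1 numeral_eq_one_iff semiring_norm(85))
    then obtain \<alpha> where \<alpha>: "\<alpha> \<in> adjoin w" "poly (map_poly to_ac p) \<alpha> = 0"
      using root_in_adjoin[OF w] by blast
    then obtain u v where uv: "\<alpha> = to_ac u + to_ac v * w" unfolding adjoin_def by blast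
    have step: ?thesis if pq: "p = q * g" "degree q > 0" "sgn (poly q a) = sgn (poly q b)" for q g
    proof -
      have "g \<noteq> 0" "q \<noteq> 0" using pq False by auto
      hence "degree g < degree p" using pq by (simp add: degree_mult_eq)
      moreover have "poly g x \<noteq> 0" if "a \<le> x" "x \<le> b" for x
        using less.prems[OF that] pq by auto
      ultimately have "sgn (poly g a) = sgn (poly g b)" using less.hyps by blast
      thus ?thesis using pq by (simp add: sgn_mult)
    qed
    show ?thesis
    proof (cases "v = 0")
      case True
      hence "poly p u = 0" using \<alpha> uv by (simp add: poly_map_poly_to_ac)
      hence "\<not> (a \<le> u \<and> u \<le> b)" using less.prems by blast
      moreover obtain g where "p = [:- u, 1:] * g"
        using \<open>poly p u = 0\<close> by (metis dvd_def poly_eq_0_iff_dvd)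
      ultimately show ?thesis using assms(1)
        by (intro step[of "[:- u, 1:]" g]) (auto simp: sgn_if)
    next
      case v: False
      \<comment> \<open>The remainder of \<open>p\<close> modulo \<open>q = (X - u)\<^sup>2 + v\<^sup>2\<close> is linear and vanishes at \<open>\<alpha>\<close>,
      which does not lie in the base field; so it is zero.\<close>
      define q where "q = [:u * u + v * v, - (2 * u), 1:]"
      have qpos: "poly q x > 0" for x
      proof -
        have "poly q x = (x - u) * (x - u) + v * v" by (simp add: q_def algebra_simps)
        also have "\<dots> > 0" using v by (intro add_nonneg_pos) (auto simp: zero_less_mult_iff)
        finally show ?thesis .
      qed
      have "to_ac v * w * (to_ac v * w) = - to_ac (v * v)"
        using w by (metis (no_types, lifting) ab_semigroup_mult_class.mult_ac(1) mult.left_commute mult_minus1_right to_ac_mult)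
      hence q\<alpha>: "poly (map_poly to_ac q) \<alpha> = 0"
        by (simp add: q_def uv map_poly_pCons algebra_simps)
      define r where "r = p mod q"
      have dq: "degree q = 2" by (simp add: q_def)
      hence "degree r < 2 \<or> r = 0" 
        unfolding r_def using degree_mod_less[of q p] by fastforce
      hence "r = [:coeff r 0, coeff r 1:]"
        by (intro poly_eqI) (auto simp: coeff_pCons coeff_eq_0 split: nat.splits)
      then obtain c e where r: "r = [:c, e:]" by blast
      have "p = (p div q) * q + r" by (simp add: r_def)
      hence "map_poly to_ac p = map_poly to_ac (p div q) * map_poly to_ac q + map_poly to_ac r"
        by (metis map_poly_to_ac_add map_poly_to_ac_mult)
      hence "poly (map_poly to_ac r) \<alpha> = 0" using \<alpha> q\<alpha> by simp
      hence eq: "to_ac (c + u * e) + to_ac (v * e) * w = 0"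
        by (simp add: r uv map_poly_pCons algebra_simps)
      have "e = 0"
      proof (rule ccontr)
        assume "e \<noteq> 0"
        hence "w = to_ac (- (c + u * e) / (v * e))" using eq v by (simp add: field_simps eq_neg_iff_add_eq_0)
        then obtain s where "w = to_ac s" by blast
        hence "to_ac (s * s) = to_ac (-1)" using w by simp
        hence "s * s = -1" by (simp only: to_ac_eq_iff)
        moreover have "s * s \<ge> 0" by simp
        ultimately show False by simp
      qed
      hence "r = 0" using eq r by simp
      hence "p = q * (p div q)" unfolding r_def by (simp add: mod_eq_0_iff_dvd)
      thus ?thesis using qpos dq by (intro step[of q "p div q"]) auto
    qed
  qed
qed

lemma polynomial_ivt:
  fixes p :: "'a::real_closed_field poly"
  assumes "a \<le> b" "sgn (poly p a) \<noteq> sgn (poly p b)"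
  obtains x where "a \<le> x" "x \<le> b" "poly p x = 0"
  using no_root_imp_same_sign[of a b p] assms by blast

section \<open>Rolle's theorem and gaps between roots\<close>

text \<open>
  Without completeness there is no extremum to look at. Between two adjacent roots \<open>a < d\<close> write
  \<open>p = (X - a)\<^bsup>m+1\<^esup> (X - d)\<^bsup>n+1\<^esup> g\<close> with \<open>g\<close> of constant sign. Then
  \<open>p' = (X - a)\<^sup>m (X - d)\<^sup>n r\<close>, and \<open>r\<close> has opposite signs at \<open>a\<close> and \<open>d\<close>.
\<close>

lemma poly_rolle:
  fixes p :: "'a::real_closed_field poly"
  assumes "a < b" "poly p a = 0" "poly p b = 0"
  shows "\<exists>c. a < c \<and> c < b \<and> poly (pderiv p) c = 0"
proof (cases "p = 0")
  case True
  then show ?thesis using dense[OF assms(1)] by auto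
next
  case False
  define Z where "Z = {x. a < x \<and> x \<le> b \<and> poly p x = 0}"
  have fin: "finite Z" by (rule finite_subset[OF _ poly_roots_finite[OF False]]) (auto simp: Z_def)
  have "b \<in> Z" using assms by (simp add: Z_def)
  define d where "d = Min Z"
  have "d \<in> Z" unfolding d_def using fin \<open>b \<in> Z\<close> by (intro Min_in) auto
  have dmin: "d \<le> z" if "z \<in> Z" for z unfolding d_def using fin that by simp
  have d: "a < d" "d \<le> b" "poly p d = 0" using \<open>d \<in> Z\<close> by (auto simp: Z_def)
  obtain f where f: "p = [:-a, 1:] ^ order a p * f" "\<not> [:-a, 1:] dvd f"
    using order_decomp[OF False] by blast
  have "f \<noteq> 0" "poly f a \<noteq> 0" using f by (auto simp: poly_eq_0_iff_dvd)
  obtain g where g: "f = [:-d, 1:] ^ order d f * g" "\<not> [:-d, 1:] dvd g"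
    using order_decomp[OF \<open>f \<noteq> 0\<close>] by blast
  have "order a p \<noteq> 0" using False assms by (simp add: order_root)
  then obtain m where m: "order a p = Suc m" using not0_implies_Suc by blast
  have "poly p d = (d - a) ^ Suc m * poly f d" unfolding m[symmetric] by (subst f(1)) simp
  hence "poly f d = 0" using d by simp
  hence "order d f \<noteq> 0" using \<open>f \<noteq> 0\<close> by (simp add: order_root)
  then obtain n where n: "order d f = Suc n" using not0_implies_Suc by blast
  have p: "p = [:-a, 1:] ^ Suc m * ([:-d, 1:] ^ Suc n * g)" using f(1) g(1) m n by metis
  have gnz: "poly g x \<noteq> 0" if "a \<le> x" "x \<le> d" for x
  proof
    assume "poly g x = 0"
    hence "poly f x = 0" by (subst g(1)) simp
    moreover have "poly p x = 0" by (subst f(1)) (simp add: \<open>poly f x = 0\<close>)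
    ultimately have px: "poly p x = 0" "poly f x = 0" by auto
    have "x \<noteq> a" using px \<open>poly f a \<noteq> 0\<close> by auto
    moreover have "x \<noteq> d" using g(2) \<open>poly g x = 0\<close> by (auto simp: poly_eq_0_iff_dvd)
    ultimately show False using dmin[of x] that d px by (auto simp: Z_def)
  qed
  define r where "r = smult (of_nat (Suc m)) ([:-d, 1:] * g) + smult (of_nat (Suc n)) ([:-a, 1:] * g) + [:-a, 1:] * [:-d, 1:] * pderiv g"
  have r: "poly r x = of_nat (Suc m) * ((x - d) * poly g x) + of_nat (Suc n) * ((x - a) * poly g x)
      + (x - a) * ((x - d) * poly (pderiv g) x)" for x
    by (simp add: r_def del: mult_pCons_left of_nat_Suc) (simp add: algebra_simps)
  have pr: "poly (pderiv p) x = (x - a) ^ m * (x - d) ^ n * poly r x" for x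
  proof -
    have "poly (pderiv p) x = of_nat (Suc m) * (x - a) ^ m * ((x - d) ^ Suc n * poly g x)
        + (x - a) ^ Suc m * (of_nat (Suc n) * (x - d) ^ n * poly g x + (x - d) ^ Suc n * poly (pderiv g) x)"
      unfolding p pderiv_mult pderiv_power_Suc
      by (simp add: pderiv_pCons del: mult_pCons_left of_nat_Suc power_Suc)
    thus ?thesis unfolding r by (simp add: algebra_simps del: of_nat_Suc)
  qed
  have "sgn (poly g a) = sgn (poly g d)" using gnz d by (intro no_root_imp_same_sign) auto
  moreover have "poly r a = of_nat (Suc m) * ((a - d) * poly g a)"
    "poly r d = of_nat (Suc n) * ((d - a) * poly g d)"
    by (simp_all add: r)
  ultimately have "sgn (poly r a) = - sgn (poly r d)"
    using d by (simp add: sgn_mult del: of_nat_Suc)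
  moreover have "poly r a \<noteq> 0" "poly r d \<noteq> 0" using gnz[of a] gnz[of d] d by (auto simp: r simp del: of_nat_Suc)
  ultimately have "sgn (poly r a) \<noteq> sgn (poly r d)" by (auto simp: sgn_if split: if_splits)
  then obtain c where c: "a \<le> c" "c \<le> d" "poly r c = 0" using polynomial_ivt[of a d r] d by auto
  hence "c \<noteq> a" "c \<noteq> d" using \<open>poly r a \<noteq> 0\<close> \<open>poly r d \<noteq> 0\<close> by auto
  thus ?thesis using c d pr by (intro exI[of _ c]) auto
qed

lemma poly_mean_value:
  fixes p :: "'a::real_closed_field poly"
  assumes "a < b"
  obtains c where "a < c" "c < b" "poly p b - poly p a = (b - a) * poly (pderiv p) c"
proof -
  define s where "s = (poly p b - poly p a) / (b - a)"
  define q where "q = p - [:poly p a - a * s, s:]"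
  have "poly q a = 0" by (simp add: q_def)
  moreover have "poly q b = 0"
  proof -
    have "poly q b = (poly p b - poly p a) - (b - a) * s" by (simp add: q_def algebra_simps)
    also have "\<dots> = 0" using assms by (simp add: s_def)
    finally show ?thesis .
  qed
  ultimately obtain c where c: "a < c" "c < b" "poly (pderiv q) c = 0" using poly_rolle[OF assms] by blast
  hence "poly (pderiv p) c = s" by (simp add: q_def pderiv_diff pderiv_pCons)
  thus ?thesis using that[of c] c assms by (simp add: s_def)
qed

lemma poly_unbounded_above:
  fixes p :: "'a::linordered_field poly"
  assumes "degree p > 0"
  shows "\<exists>N. \<forall>x\<ge>N. \<bar>poly p x\<bar> > M"
  using assms
proof (induction p arbitrary: M)
  case (pCons a q)
  have "\<exists>c>0. \<exists>N. \<forall>x\<ge>N. \<bar>poly q x\<bar> \<ge> c"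
  proof (cases "degree q = 0")
    case True
    then obtain c where "q = [:c:]" by (metis degree_eq_zeroE)
    thus ?thesis using pCons.prems by (intro exI[of _ "\<bar>c\<bar>"]) (auto split: if_splits)
  next
    case False
    hence "\<exists>N. \<forall>x\<ge>N. \<bar>poly q x\<bar> > 1" using pCons.IH by blast
    thus ?thesis by (intro exI[of _ 1]) (auto intro: less_imp_le)
  qed
  then obtain c N where c: "c > 0" "\<And>x. x \<ge> N \<Longrightarrow> \<bar>poly q x\<bar> \<ge> c" by blast
  define N' where "N' = max N ((\<bar>M\<bar> + \<bar>a\<bar> + 1) / c)"
  have "\<bar>poly (pCons a q) x\<bar> > M" if "x \<ge> N'" for x
  proof -
    have x: "x \<ge> N" "x \<ge> (\<bar>M\<bar> + \<bar>a\<bar> + 1) / c" using that by (auto simp: N'_def)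
    moreover have "(\<bar>M\<bar> + \<bar>a\<bar> + 1) / c > 0" using c by (intro divide_pos_pos) auto
    ultimately have "x > 0" by simp
    have "\<bar>M\<bar> + \<bar>a\<bar> + 1 \<le> x * c" using x c by (simp add: field_simps)
    also have "\<dots> \<le> x * \<bar>poly q x\<bar>" using \<open>x > 0\<close> c x by (intro mult_left_mono) auto
    also have "\<dots> = \<bar>x * poly q x\<bar>" using \<open>x > 0\<close> by (simp add: abs_mult)
    finally show ?thesis by simp
  qed
  thus ?case by blast
qed simp

lemma poly_unbounded_below:
  fixes p :: "'a::linordered_field poly"
  assumes "degree p > 0"
  shows "\<exists>N. \<forall>x\<le>N. \<bar>poly p x\<bar> > M"
proof -
  have "degree (pcompose p [:0, -1:]) > 0" using assms by (simp add: degree_pcompose)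
  then obtain N where "\<forall>x\<ge>N. \<bar>poly (pcompose p [:0, -1:]) x\<bar> > M" using poly_unbounded_above by blast
  hence N: "\<bar>poly p (- x)\<bar> > M" if "x \<ge> N" for x using that by (simp add: poly_pcompose)
  have "\<forall>x\<le>-N. \<bar>poly p x\<bar> > M" using N[of "- x" for x] by force
  thus ?thesis by blast
qed

text \<open>
  Gaps between consecutive roots are open intervals that may be unbounded: \<^const>\<open>None\<close> stands for
  \<open>-\<infinity>\<close> as a left end and for \<open>+\<infinity>\<close> as a right end.
\<close>

definition between :: "'a::linorder option \<Rightarrow> 'a option \<Rightarrow> 'a \<Rightarrow> bool" where
  "between a b x \<longleftrightarrow> (\<forall>u. a = Some u \<longrightarrow> u < x) \<and> (\<forall>u. b = Some u \<longrightarrow> x < u)"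

lemma between_convex: "between a b x \<Longrightarrow> between a b z \<Longrightarrow> x \<le> y \<Longrightarrow> y \<le> z \<Longrightarrow> between a b y"
  unfolding between_def by force

lemma between_Some: "between a (Some b) x \<longleftrightarrow> between a None x \<and> x < b"
  "between (Some b) c x \<longleftrightarrow> b < x \<and> between None c x"
  by (auto simp: between_def)

lemma between_nonempty:
  fixes a :: "'a::linordered_field option"
  shows "between a None b \<Longrightarrow> \<exists>x. between a (Some b) x" "\<exists>x. between a None x"
  by (cases a; simp add: between_def dense gt_ex lt_ex)+

lemma between_infinite:
  fixes a :: "'a::linordered_field option"
  assumes "between a b x"
  shows "infinite {y. between a b y}"
proof
  assume fin: "finite {y. between a b y}"
  define m where "m = Max {y. between a b y}"
  have m: "between a b m" using Max_in[OF fin] assms by (auto simp: m_def)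
  have "\<exists>y>m. between a b y"
  proof (cases b)
    case None
    thus ?thesis using gt_ex[of m] m by (force simp: between_def)
  next
    case (Some u)
    thus ?thesis using dense[of m u] m by (force simp: between_def)
  qed
  then obtain y where "y > m" "between a b y" by blast
  thus False using Max_ge[OF fin, of y] by (auto simp: m_def)
qed

text \<open>
  On a gap where the derivative is positive, whether the polynomial is positive throughout or
  negative throughout can be read off at the ends. At an infinite end this uses that nonconstant
  polynomials are unbounded: an increasing polynomial cannot stay positive down to \<open>-\<infinity>\<close>.
\<close>

lemma
  fixes p :: "'a::real_closed_field poly"
  assumes pos: "\<And>x. between a b x \<Longrightarrow> poly (pderiv p) x > 0"
    and x0: "between a b x0"
  shows increasing_positive: "(\<forall>x. between a b x \<longrightarrow> poly p x > 0) \<longleftrightarrow> (\<exists>u. a = Some u \<and> poly p u \<ge> 0)"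
    and increasing_negative: "(\<forall>x. between a b x \<longrightarrow> poly p x < 0) \<longleftrightarrow> (\<exists>u. b = Some u \<and> poly p u \<le> 0)"
    and increasing_mono: "\<And>x y. between a b x \<Longrightarrow> between a b y \<Longrightarrow> x < y \<Longrightarrow> poly p x < poly p y"
proof -
  have less: "poly p x < poly p y" if xy: "x < y" "\<And>z. x < z \<Longrightarrow> z < y \<Longrightarrow> between a b z" for x y
  proof -
    obtain c where c: "x < c" "c < y" "poly p y - poly p x = (y - x) * poly (pderiv p) c"
      using poly_mean_value[OF xy(1)] by blast
    have "(y - x) * poly (pderiv p) c > 0" using c xy(1) pos[OF xy(2)] by simp
    thus ?thesis using c by simp
  qed
  show mono: "\<And>x y. between a b x \<Longrightarrow> between a b y \<Longrightarrow> x < y \<Longrightarrow> poly p x < poly p y"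
    by (intro less) (auto intro: between_convex less_imp_le)
  have deg: "degree p > 0"
  proof (rule ccontr)
    assume "\<not> degree p > 0"
    hence "pderiv p = 0" by (simp add: pderiv_eq_0_iff)
    thus False using pos[OF x0] by simp
  qed
  show "(\<forall>x. between a b x \<longrightarrow> poly p x > 0) \<longleftrightarrow> (\<exists>u. a = Some u \<and> poly p u \<ge> 0)"
  proof
    assume L: "\<forall>x. between a b x \<longrightarrow> poly p x > 0"
    show "\<exists>u. a = Some u \<and> poly p u \<ge> 0"
    proof (cases a)
      case None
      obtain N where N: "\<forall>x\<le>N. \<bar>poly p x\<bar> > poly p x0" using poly_unbounded_below[OF deg] by blast
      define x where "x = min N (x0 - 1)"
      have x: "between a b x" using x0 None by (auto simp: between_def x_def)
      have "poly p x < poly p x0" by (rule mono[OF x x0]) (simp add: x_def)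
      moreover have "\<bar>poly p x\<bar> > poly p x0" using N by (simp add: x_def)
      ultimately show ?thesis using L x by force
    next
      case (Some u)
      have "poly p u \<ge> 0"
      proof (rule ccontr)
        assume neg: "\<not> poly p u \<ge> 0"
        moreover have "u < x0" "poly p x0 > 0" using x0 L Some by (auto simp: between_def)
        ultimately have "u \<le> x0" "sgn (poly p u) \<noteq> sgn (poly p x0)" by (auto simp: sgn_if)
        then obtain c where c: "u \<le> c" "c \<le> x0" "poly p c = 0" by (rule polynomial_ivt)
        hence "u \<noteq> c" using neg by auto
        hence "between a b c" using c x0 Some by (auto simp: between_def)
        thus False using L c by force
      qed
      thus ?thesis using Some by simp
    qed
  next
    assume "\<exists>u. a = Some u \<and> poly p u \<ge> 0"
    then obtain u where u: "a = Some u" "poly p u \<ge> 0" by blast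
    show "\<forall>x. between a b x \<longrightarrow> poly p x > 0"
    proof (intro allI impI)
      fix x assume x: "between a b x"
      have "poly p u < poly p x" using x u by (intro less) (auto simp: between_def)
      thus "poly p x > 0" using u by simp
    qed
  qed
  show "(\<forall>x. between a b x \<longrightarrow> poly p x < 0) \<longleftrightarrow> (\<exists>u. b = Some u \<and> poly p u \<le> 0)"
  proof
    assume L: "\<forall>x. between a b x \<longrightarrow> poly p x < 0"
    show "\<exists>u. b = Some u \<and> poly p u \<le> 0"
    proof (cases b)
      case None
      obtain N where N: "\<forall>x\<ge>N. \<bar>poly p x\<bar> > - poly p x0" using poly_unbounded_above[OF deg] by blast
      define x where "x = max N (x0 + 1)"
      have x: "between a b x" using x0 None by (auto simp: between_def x_def less_max_iff_disj)
      have "poly p x0 < poly p x" by (rule mono[OF x0 x]) (simp add: x_def less_max_iff_disj)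
      moreover have "\<bar>poly p x\<bar> > - poly p x0" using N by (simp add: x_def)
      ultimately show ?thesis using L x by force
    next
      case (Some u)
      have "poly p u \<le> 0"
      proof (rule ccontr)
        assume neg: "\<not> poly p u \<le> 0"
        moreover have "x0 < u" "poly p x0 < 0" using x0 L Some by (auto simp: between_def)
        ultimately have "x0 \<le> u" "sgn (poly p x0) \<noteq> sgn (poly p u)" by (auto simp: sgn_if)
        then obtain c where c: "x0 \<le> c" "c \<le> u" "poly p c = 0" by (rule polynomial_ivt)
        hence "u \<noteq> c" using neg by auto
        hence "between a b c" using c x0 Some by (auto simp: between_def)
        thus False using L c by force
      qed
      thus ?thesis using Some by simp
    qed
  next
    assume "\<exists>u. b = Some u \<and> poly p u \<le> 0"
    then obtain u where u: "b = Some u" "poly p u \<le> 0" by blast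
    show "\<forall>x. between a b x \<longrightarrow> poly p x < 0"
    proof (intro allI impI)
      fix x assume x: "between a b x"
      have "poly p x < poly p u" using x u by (intro less) (auto simp: between_def)
      thus "poly p x < 0" using u by simp
    qed
  qed
qed

section \<open>Sign patterns on the line\<close>

lemma no_root_on_gap_imp_same_sign:
  fixes p :: "'a::real_closed_field poly"
  assumes "\<And>x. between a b x \<Longrightarrow> poly p x \<noteq> 0" "between a b x" "between a b y"
  shows "sgn (poly p x) = sgn (poly p y)"
proof (cases "x \<le> y")
  case True
  thus ?thesis using assms by (intro no_root_imp_same_sign) (auto intro: between_convex)
next
  case False
  hence "sgn (poly p y) = sgn (poly p x)" using assms by (intro no_root_imp_same_sign) (auto intro: between_convex)
  thus ?thesis by simp
qed

text \<open>
  An increasing polynomial is positive on the gap, or negative, or has a single root at which it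
  changes from negative to positive. Which case occurs is decided by the signs at the ends, and
  these are the same for \<open>p\<close> and \<open>q\<close>.
\<close>

lemma increasing_pair_on_gap:
  fixes p q :: "'a::real_closed_field poly"
  assumes p: "\<And>x. between a b x \<Longrightarrow> poly (pderiv p) x > 0" "between a b x0"
    and q: "\<And>x. between a' b' x \<Longrightarrow> poly (pderiv q) x > 0" "between a' b' x0'"
    and a: "rel_option (\<lambda>u u'. sgn (poly p u) = sgn (poly q u')) a a'"
    and b: "rel_option (\<lambda>u u'. sgn (poly p u) = sgn (poly q u')) b b'"
  shows "(\<forall>x x'. between a b x \<longrightarrow> between a' b' x' \<longrightarrow> sgn (poly p x) = sgn (poly q x')) \<or>
    (\<exists>c c'. between a b c \<and> between a' b' c' \<and> sgn (poly p c) = sgn (poly q c') \<and>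
      (\<forall>x x'. between a (Some c) x \<longrightarrow> between a' (Some c') x' \<longrightarrow> sgn (poly p x) = sgn (poly q x')) \<and>
      (\<forall>x x'. between (Some c) b x \<longrightarrow> between (Some c') b' x' \<longrightarrow> sgn (poly p x) = sgn (poly q x')))"
proof -
  have sgn_le: "sgn s = sgn t \<Longrightarrow> (s \<ge> 0 \<longleftrightarrow> t \<ge> 0) \<and> (s \<le> 0 \<longleftrightarrow> t \<le> 0)" for s t :: 'a
    by (cases s "0::'a" rule: linorder_cases; cases t "0::'a" rule: linorder_cases; simp)
  have "(\<forall>x. between a b x \<longrightarrow> poly p x > 0) \<longleftrightarrow> (\<exists>u. a = Some u \<and> poly p u \<ge> 0)"
    by (rule increasing_positive[OF p])
  also have "\<dots> \<longleftrightarrow> (\<exists>u. a' = Some u \<and> poly q u \<ge> 0)"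
  proof (cases a)
    case (Some u)
    then obtain u' where "a' = Some u'" "sgn (poly p u) = sgn (poly q u')" using a by (cases a') auto
    thus ?thesis using Some sgn_le[of "poly p u" "poly q u'"] by simp
  qed (use a in simp)
  also have "\<dots> \<longleftrightarrow> (\<forall>x. between a' b' x \<longrightarrow> poly q x > 0)"
    by (rule increasing_positive[OF q, symmetric])
  finally have pos_iff: "(\<forall>x. between a b x \<longrightarrow> poly p x > 0) \<longleftrightarrow> (\<forall>x. between a' b' x \<longrightarrow> poly q x > 0)" .
  have "(\<forall>x. between a b x \<longrightarrow> poly p x < 0) \<longleftrightarrow> (\<exists>u. b = Some u \<and> poly p u \<le> 0)"
    by (rule increasing_negative[OF p])
  also have "\<dots> \<longleftrightarrow> (\<exists>u. b' = Some u \<and> poly q u \<le> 0)"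
  proof (cases b)
    case (Some u)
    then obtain u' where "b' = Some u'" "sgn (poly p u) = sgn (poly q u')" using b by (cases b') auto
    thus ?thesis using Some sgn_le[of "poly p u" "poly q u'"] by simp
  qed (use b in simp)
  also have "\<dots> \<longleftrightarrow> (\<forall>x. between a' b' x \<longrightarrow> poly q x < 0)"
    by (rule increasing_negative[OF q, symmetric])
  finally have neg_iff: "(\<forall>x. between a b x \<longrightarrow> poly p x < 0) \<longleftrightarrow> (\<forall>x. between a' b' x \<longrightarrow> poly q x < 0)" .
  have root: "\<exists>c. between a b c \<and> poly f c = 0"
    if asm: "\<not> (\<forall>x. between a b x \<longrightarrow> poly f x > 0)" "\<not> (\<forall>x. between a b x \<longrightarrow> poly f x < 0)"
    for f :: "'a poly" and a b
  proof (rule ccontr)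
    assume no: "\<nexists>c. between a b c \<and> poly f c = 0"
    obtain x y where xy: "between a b x" "\<not> poly f x > 0" "between a b y" "\<not> poly f y < 0" using asm by blast
    have "sgn (poly f x) = sgn (poly f y)"
      by (rule no_root_on_gap_imp_same_sign[of a b]) (use no xy in auto)
    moreover have "poly f x < 0" "poly f y > 0" using no xy by (metis linorder_neqE)+
    ultimately show False by simp
  qed
  consider "\<forall>x. between a b x \<longrightarrow> poly p x > 0" | "\<forall>x. between a b x \<longrightarrow> poly p x < 0"
    | "\<not> (\<forall>x. between a b x \<longrightarrow> poly p x > 0)" "\<not> (\<forall>x. between a b x \<longrightarrow> poly p x < 0)" by blast
  thus ?thesis
  proof cases
    case 1
    thus ?thesis using pos_iff by simp
  next
    case 2
    thus ?thesis using neg_iff by simp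
  next
    case 3
    obtain c where c: "between a b c" "poly p c = 0" using root[OF 3] by blast
    obtain c' where c': "between a' b' c'" "poly q c' = 0" using root[of a' b' q] 3 pos_iff neg_iff by blast
    have "poly p x < 0" if "between a (Some c) x" for x
      using increasing_mono[OF p(1) p(2), of x c] c that by (force simp: between_def)
    moreover have "poly q x < 0" if "between a' (Some c') x" for x
      using increasing_mono[OF q(1) q(2), of x c'] c' that by (force simp: between_def)
    moreover have "poly p x > 0" if "between (Some c) b x" for x
      using increasing_mono[OF p(1) p(2), of c x] c that by (force simp: between_def)
    moreover have "poly q x > 0" if "between (Some c') b' x" for x
      using increasing_mono[OF q(1) q(2), of c' x] c' that by (force simp: between_def)
    ultimately show ?thesis using c c'
      by - (rule disjI2, rule exI[of _ c], rule exI[of _ c'], simp)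
  qed
qed

text \<open>
  The elements of \<open>Q\<close> are pairs of polynomials that correspond to each other; in the application
  they are the two specialisations of one parametric polynomial at two parameter values.
\<close>

definition agree :: "('a::linordered_field poly \<times> 'a poly) set \<Rightarrow> 'a \<Rightarrow> 'a \<Rightarrow> bool" where
  "agree Q x x' \<longleftrightarrow> (\<forall>(p, q)\<in>Q. sgn (poly p x) = sgn (poly q x'))"

lemma agree_insert: "agree (insert (p, q) Q) x x' \<longleftrightarrow> sgn (poly p x) = sgn (poly q x') \<and> agree Q x x'"
  by (simp add: agree_def)

lemma agree_subset: "agree Q x x' \<Longrightarrow> R \<subseteq> Q \<Longrightarrow> agree R x x'"
  by (auto simp: agree_def)

text \<open>
  If a family \<open>J\<close> containing the derivative of \<open>p\<close> has no roots in a gap, then \<open>p\<close> is strictly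
  monotone there and has at most one root, whose existence depends on the signs at the ends. So
  a gap for \<open>J\<close> splits into at most two gaps and one point when \<open>p\<close> is added.
\<close>

lemma refine_gap:
  fixes J :: "('a::real_closed_field poly \<times> 'a poly) set"
  assumes noroot: "\<forall>f g x. (f, g) \<in> J \<longrightarrow> between a b x \<longrightarrow> poly f x \<noteq> 0"
      "\<forall>f g x. (f, g) \<in> J \<longrightarrow> between a' b' x \<longrightarrow> poly g x \<noteq> 0"
    and x0: "between a b x0" "between a' b' x0'" "agree J x0 x0'"
    and pq: "(pderiv p, pderiv q) \<in> J"
    and a: "rel_option (\<lambda>u u'. sgn (poly p u) = sgn (poly q u')) a a'"
    and b: "rel_option (\<lambda>u u'. sgn (poly p u) = sgn (poly q u')) b b'"
  shows "(\<forall>x x'. between a b x \<longrightarrow> between a' b' x' \<longrightarrow> agree (insert (p, q) J) x x') \<or>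
    (\<exists>c c'. between a b c \<and> between a' b' c' \<and> agree (insert (p, q) J) c c' \<and>
      (\<forall>x x'. between a (Some c) x \<longrightarrow> between a' (Some c') x' \<longrightarrow> agree (insert (p, q) J) x x') \<and>
      (\<forall>x x'. between (Some c) b x \<longrightarrow> between (Some c') b' x' \<longrightarrow> agree (insert (p, q) J) x x'))"
proof -
  have same: "sgn (poly f x) = sgn (poly g x')" if fg: "(f, g) \<in> J" and x: "between a b x" "between a' b' x'" for f g x x'
  proof -
    have "sgn (poly f x) = sgn (poly f x0)"
      by (rule no_root_on_gap_imp_same_sign[OF _ x(1) x0(1)]) (use noroot(1) fg in blast)
    also have "\<dots> = sgn (poly g x0')" using x0(3) fg by (auto simp: agree_def)
    also have "\<dots> = sgn (poly g x')"
      by (rule no_root_on_gap_imp_same_sign[OF _ x0(2) x(2)]) (use noroot(2) fg in blast)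
    finally show ?thesis .
  qed
  have J: "agree J x x'" if "between a b x" "between a' b' x'" for x x'
    using same that by (auto simp: agree_def)
  have "(\<forall>x x'. between a b x \<longrightarrow> between a' b' x' \<longrightarrow> sgn (poly p x) = sgn (poly q x')) \<or>
    (\<exists>c c'. between a b c \<and> between a' b' c' \<and> sgn (poly p c) = sgn (poly q c') \<and>
      (\<forall>x x'. between a (Some c) x \<longrightarrow> between a' (Some c') x' \<longrightarrow> sgn (poly p x) = sgn (poly q x')) \<and>
      (\<forall>x x'. between (Some c) b x \<longrightarrow> between (Some c') b' x' \<longrightarrow> sgn (poly p x) = sgn (poly q x')))"
  proof (cases "poly (pderiv p) x0 > 0")
    case True
    have "poly (pderiv q) x > 0" if "between a' b' x" for x
      using same[OF pq x0(1) that] True by (simp add: sgn_1_pos)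
    moreover have "poly (pderiv p) x > 0" if "between a b x" for x
      using same[OF pq that x0(2)] same[OF pq x0(1,2)] True by (simp add: sgn_1_pos)
    ultimately show ?thesis using a b x0 by (intro increasing_pair_on_gap)
  next
    case False
    hence neg: "sgn (poly (pderiv p) x0) = -1"
      using False noroot(1) pq x0(1) by (auto simp: sgn_if)
    have q: "poly (pderiv (- q)) x > 0" if "between a' b' x" for x
    proof -
      have "sgn (poly (pderiv q) x) = -1" unfolding same[OF pq x0(1) that, symmetric] by (rule neg)
      thus ?thesis by (simp add: pderiv_minus sgn_1_neg)
    qed
    have p: "poly (pderiv (- p)) x > 0" if "between a b x" for x
    proof -
      have "sgn (poly (pderiv p) x) = -1"
        unfolding same[OF pq that x0(2)] same[OF pq x0(1,2), symmetric] by (rule neg)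
      thus ?thesis by (simp add: pderiv_minus sgn_1_neg)
    qed
    show ?thesis
      using increasing_pair_on_gap[OF p x0(1) q x0(2)] a b by (simp add: sgn_minus)
  qed
  thus ?thesis
  proof (elim disjE exE conjE, goal_cases)
    case 1
    thus ?case using J by (simp add: agree_insert)
  next
    case (2 c c')
    have "agree (insert (p, q) J) x x'" if "between a (Some c) x" "between a' (Some c') x'" for x x'
    proof -
      have "between a b x" "between a' b' x'" using that 2(1,2) by (auto simp: between_def)
      thus ?thesis using 2(4) that J by (simp add: agree_insert)
    qed
    moreover have "agree (insert (p, q) J) x x'" if "between (Some c) b x" "between (Some c') b' x'" for x x'
    proof -
      have "between a b x" "between a' b' x'" using that 2(1,2) by (auto simp: between_def)
      thus ?thesis using 2(5) that J by (simp add: agree_insert)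
    qed
    moreover have "agree (insert (p, q) J) c c'" using 2(1,2,3) J by (simp add: agree_insert)
    ultimately show ?case using 2(1,2) by blast
  qed
qed

text \<open>
  The two components of the pairs in \<open>Q\<close> have the same sign pattern to the right of \<open>a\<close> and
  \<open>a'\<close>: the half-lines can be cut at finitely many corresponding points such that the signs
  agree at corresponding points and throughout corresponding gaps. The points are listed from
  left to right, which turns statements about whole patterns into rule inductions that treat one
  gap at a time.
\<close>

inductive same_pattern :: "('a::linordered_field poly \<times> 'a poly) set \<Rightarrow> 'a option \<Rightarrow> 'a option \<Rightarrow> bool"
  for Q where
  last: "(\<And>x x'. between a None x \<Longrightarrow> between a' None x' \<Longrightarrow> agree Q x x') \<Longrightarrow> same_pattern Q a a'"
| step: "between a None b \<Longrightarrow> between a' None b' \<Longrightarrow>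
    (\<And>x x'. between a (Some b) x \<Longrightarrow> between a' (Some b') x' \<Longrightarrow> agree Q x x') \<Longrightarrow>
    agree Q b b' \<Longrightarrow> same_pattern Q (Some b) (Some b') \<Longrightarrow> same_pattern Q a a'"

text \<open>
  This is what elimination needs from a pattern: every sign vector attained by the first
  components is attained by the second components.
\<close>

lemma same_pattern_transfers_points:
  assumes "same_pattern Q a a'" "between a None x"
  shows "\<exists>x'. between a' None x' \<and> agree Q x x'"
  using assms
proof (induction)
  case (last a a')
  thus ?case using between_nonempty(2)[of a'] by blast
next
  case (step a b a' b')
  consider "x < b" | "x = b" | "x > b" by force
  thus ?case
  proof cases
    case 1
    obtain x' where "between a' (Some b') x'" using between_nonempty(1)[OF step(2)] by blast
    moreover have "between a (Some b) x" using 1 step.prems by (simp add: between_Some)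
    ultimately show ?thesis using step(3) by (auto simp: between_Some)
  next
    case 2
    thus ?thesis using step by blast
  next
    case 3
    hence "between (Some b) None x" by (simp add: between_def)
    then obtain x' where "between (Some b') None x'" "agree Q x x'" using step.IH by blast
    moreover have "between a' None x'" using calculation(1) step(2) by (auto simp: between_def)
    ultimately show ?thesis by blast
  qed
qed

lemma same_pattern_mono:
  "same_pattern Q a a' \<Longrightarrow> (\<And>x x'. agree Q x x' \<Longrightarrow> agree R x x') \<Longrightarrow> same_pattern R a a'"
  by (induction rule: same_pattern.induct) (blast intro: same_pattern.intros)+

text \<open>
  A root of \<open>f\<close> in the gap would make \<open>g\<close> vanish on the whole corresponding gap, which is
  infinite.
\<close>

lemma agree_on_gap_imp_no_root:
  fixes J :: "('a::linordered_field poly \<times> 'a poly) set"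
  assumes gap: "\<And>x x'. between a b x \<Longrightarrow> between a' b' x' \<Longrightarrow> agree J x x'"
    and fg: "(f, g) \<in> J" "f \<noteq> 0" "g \<noteq> 0"
    and ne: "between a b x" "between a' b' x'"
  shows "poly f x \<noteq> 0" "poly g x' \<noteq> 0"
proof -
  have eq: "sgn (poly f x) = sgn (poly g x')" if "between a b x" "between a' b' x'" for x x'
    using gap[OF that] fg by (auto simp: agree_def)
  show "poly f x \<noteq> 0"
  proof
    assume "poly f x = 0"
    hence "{y. between a' b' y} \<subseteq> {y. poly g y = 0}" using eq[OF ne(1)] by (auto simp: sgn_0_0)
    thus False using between_infinite[OF ne(2)] poly_roots_finite[OF fg(3)] finite_subset by blast
  qed
  show "poly g x' \<noteq> 0"
  proof
    assume "poly g x' = 0"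
    hence "{y. between a b y} \<subseteq> {y. poly f y = 0}" using eq[OF _ ne(2)] by (auto simp: sgn_0_0)
    thus False using between_infinite[OF ne(1)] poly_roots_finite[OF fg(2)] finite_subset by blast
  qed
qed

text \<open>
  The cutting points of the pattern of \<open>R\<close> need not be roots of members of \<open>J\<close>, and at such
  points nothing is known about the sign of \<open>p\<close>. These points must be dropped, merging the
  adjacent gaps. Hence the induction is over a statement with a second pair \<open>c\<close>, \<open>c'\<close> of
  starting points, the last cutting points retained, such that the first components of \<open>J\<close> have
  no roots in \<open>(c, a]\<close> and the second components none in \<open>(c', a']\<close>.
\<close>

lemma same_pattern_insert:
  fixes J R :: "('a::real_closed_field poly \<times> 'a poly) set"
  assumes "same_pattern R None None" "J \<subseteq> R"
    and nz: "\<And>f g. (f, g) \<in> J \<Longrightarrow> f \<noteq> 0 \<and> g \<noteq> 0"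
    and pq: "(pderiv p, pderiv q) \<in> J"
    and key: "\<And>f g z z'. (f, g) \<in> J \<Longrightarrow> agree R z z' \<Longrightarrow> poly f z = 0 \<Longrightarrow> sgn (poly p z) = sgn (poly q z')"
  shows "same_pattern (insert (p, q) J) None None"
proof -
  have *: "same_pattern (insert (p, q) J) c c'"
    if "same_pattern R a a'"
      "rel_option (\<lambda>u u'. sgn (poly p u) = sgn (poly q u')) c c'"
      "\<And>x. between a None x \<Longrightarrow> between c None x" "\<And>x. between a' None x \<Longrightarrow> between c' None x"
      "\<And>f g x. (f, g) \<in> J \<Longrightarrow> between c None x \<Longrightarrow> \<not> between a None x \<Longrightarrow> poly f x \<noteq> 0"
      "\<And>f g x. (f, g) \<in> J \<Longrightarrow> between c' None x \<Longrightarrow> \<not> between a' None x \<Longrightarrow> poly g x \<noteq> 0"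
    for a a' c c'
    using that
  proof (induction arbitrary: c c')
    case (last a a')
    obtain x0 x0' where x0: "between a None x0" "between a' None x0'" using between_nonempty(2) by blast
    have gap: "agree J x x'" if "between a None x" "between a' None x'" for x x'
      using last.hyps[OF that] assms(2) agree_subset by blast
    have nr: "poly f x \<noteq> 0" if "(f, g) \<in> J" "between c None x" for f g x
      using agree_on_gap_imp_no_root(1)[OF gap that(1) _ _ _ x0(2)] nz[OF that(1)] last.prems(4)[OF that] by blast
    have nr': "poly g x \<noteq> 0" if "(f, g) \<in> J" "between c' None x" for f g x
      using agree_on_gap_imp_no_root(2)[OF gap that(1) _ _ x0(1)] nz[OF that(1)] last.prems(5)[OF that] by blast
    have rb: "rel_option (\<lambda>u u'. sgn (poly p u) = sgn (poly q u')) None None" by simp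
    have nrs: "\<forall>f g x. (f, g) \<in> J \<longrightarrow> between c None x \<longrightarrow> poly f x \<noteq> 0"
      "\<forall>f g x. (f, g) \<in> J \<longrightarrow> between c' None x \<longrightarrow> poly g x \<noteq> 0" using nr nr' by blast+
    from refine_gap[OF nrs last.prems(2)[OF x0(1)] last.prems(3)[OF x0(2)] gap[OF x0] pq last.prems(1) rb]
    show ?case
    proof (elim disjE exE conjE, goal_cases)
      case 1
      thus ?case by (intro same_pattern.last) blast
    next
      case (2 d d')
      have "same_pattern (insert (p, q) J) (Some d) (Some d')"
        by (rule same_pattern.last) (use 2(5) in blast)
      thus ?case using same_pattern.step[OF 2(1,2) _ 2(3)] 2(4) by blast
    qed
  next
    case (step a b a' b')
    obtain x0 x0' where x0: "between a (Some b) x0" "between a' (Some b') x0'"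
      using between_nonempty(1) step.hyps by blast
    have gap: "agree J x x'" if "between a (Some b) x" "between a' (Some b') x'" for x x'
      using step.hyps(3)[OF that] assms(2) agree_subset by blast
    have cb: "between c None b" "between c' None b'" using step.prems(2,3) step.hyps(1,2) by blast+
    have bb: "agree J b b'" using step.hyps(4) assms(2) agree_subset by blast
    have nr: "poly f x \<noteq> 0" if "(f, g) \<in> J" "between c (Some b) x" for f g x
    proof (cases "between a None x")
      case True
      hence "between a (Some b) x" using that by (simp add: between_Some)
      thus ?thesis using agree_on_gap_imp_no_root(1)[OF gap that(1) _ _ _ x0(2)] nz[OF that(1)] by blast
    qed (use step.prems(4) that between_Some in blast)
    have nr': "poly g x \<noteq> 0" if "(f, g) \<in> J" "between c' (Some b') x" for f g x
    proof (cases "between a' None x")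
      case True
      hence "between a' (Some b') x" using that by (simp add: between_Some)
      thus ?thesis using agree_on_gap_imp_no_root(2)[OF gap that(1) _ _ x0(1)] nz[OF that(1)] by blast
    qed (use step.prems(5) that between_Some in blast)
    show ?case
    proof (cases "\<exists>f g. (f, g) \<in> J \<and> poly f b = 0")
      case True
      hence sb: "sgn (poly p b) = sgn (poly q b')" using key step.hyps(4) by blast
      have rest: "same_pattern (insert (p, q) J) (Some b) (Some b')"
        by (rule step.IH) (use sb in auto)
      have ab: "agree (insert (p, q) J) b b'" using sb bb by (simp add: agree_insert)
      have x0': "between c (Some b) x0" "between c' (Some b') x0'"
        using x0 step.prems(2,3) by (auto simp: between_Some)
      have rb: "rel_option (\<lambda>u u'. sgn (poly p u) = sgn (poly q u')) (Some b) (Some b')" using sb by simp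
      have nrs: "\<forall>f g x. (f, g) \<in> J \<longrightarrow> between c (Some b) x \<longrightarrow> poly f x \<noteq> 0"
        "\<forall>f g x. (f, g) \<in> J \<longrightarrow> between c' (Some b') x \<longrightarrow> poly g x \<noteq> 0" using nr nr' by blast+
      from refine_gap[OF nrs x0' gap[OF x0] pq step.prems(1) rb]
      show ?thesis
      proof (elim disjE exE conjE, goal_cases)
        case 1
        thus ?case using same_pattern.step[OF cb _ ab rest] by blast
      next
        case (2 d d')
        have db: "between (Some d) None b" "between (Some d') None b'"
          using 2(1,2) by (auto simp: between_def)
        have "same_pattern (insert (p, q) J) (Some d) (Some d')"
          by (rule same_pattern.step[OF db _ ab rest]) (use 2(5) in blast)
        moreover have "between c None d" "between c' None d'" using 2(1,2) by (auto simp: between_Some)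
        ultimately show ?case using same_pattern.step[OF _ _ _ 2(3)] 2(4) by blast
      qed
    next
      case False
      hence nb: "poly f b \<noteq> 0" if "(f, g) \<in> J" for f g using that by blast
      have nb': "poly g b' \<noteq> 0" if "(f, g) \<in> J" for f g
        using nb[OF that] bb that by (auto simp: agree_def sgn_0_0)
      show ?thesis
      proof (rule step.IH[OF step.prems(1)])
        show "between c None x" if "between (Some b) None x" for x
          using that cb(1) by (auto simp: between_def)
        show "between c' None x" if "between (Some b') None x" for x
          using that cb(2) by (auto simp: between_def)
        show "poly f x \<noteq> 0" if "(f, g) \<in> J" "between c None x" "\<not> between (Some b) None x" for f g x
        proof (cases "x = b")
          case False
          hence "between c (Some b) x" using that by (auto simp: between_def)
          thus ?thesis using nr that by blast
        qed (use nb that in blast)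
        show "poly g x \<noteq> 0" if "(f, g) \<in> J" "between c' None x" "\<not> between (Some b') None x" for f g x
        proof (cases "x = b'")
          case False
          hence "between c' (Some b') x" using that by (auto simp: between_def)
          thus ?thesis using nr' that by blast
        qed (use nb' that in blast)
      qed
    qed
  qed
  show ?thesis by (rule *[OF assms(1)]) auto
qed

section \<open>Sign patterns of parametric families\<close>

definition pairs :: "(nat \<times> ('y \<Rightarrow> 'k::zero poly)) list \<Rightarrow> 'y \<Rightarrow> 'y \<Rightarrow> ('k poly \<times> 'k poly) set" where
  "pairs ps y y' = (\<lambda>(n, P). (P y, P y')) ` set ps"

definition same_signs :: "('y \<Rightarrow> 'k::linordered_idom) set \<Rightarrow> 'y \<Rightarrow> 'y \<Rightarrow> bool" where
  "same_signs F y y' \<longleftrightarrow> (\<forall>f\<in>F. sgn (f y) = sgn (f y'))"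

text \<open>
  In each elimination step one degree bound is replaced by any number of smaller ones.
\<close>

lemma multiset_replace_less:
  fixes M N K :: "nat multiset"
  assumes "M = add_mset n N" "\<And>k. k \<in># K \<Longrightarrow> k < n"
  shows "N + K < M"
proof -
  have "multp (<) (N + K) (N + {#n#})"
    by (rule one_step_implies_multp) (use assms(2) in auto)
  thus ?thesis using assms(1) by (simp add: less_multiset_def)
qed

lemma wfp_less_nat_multiset: "wfp ((<) :: nat multiset \<Rightarrow> nat multiset \<Rightarrow> bool)"
  by (rule wfp_less_multiset) simp

text \<open>
  The coefficients of the polynomials that are eliminated are functions of a parameter \<open>y\<close>. All
  that matters about these functions is that they form a ring containing the constants.
\<close>

locale function_ring =
  fixes A :: "('y \<Rightarrow> 'k::real_closed_field) set"
  assumes const_mem: "(\<lambda>_. c) \<in> A"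
    and add_mem: "f \<in> A \<Longrightarrow> g \<in> A \<Longrightarrow> (\<lambda>y. f y + g y) \<in> A"
    and mult_mem: "f \<in> A \<Longrightarrow> g \<in> A \<Longrightarrow> (\<lambda>y. f y * g y) \<in> A"
begin

lemma diff_mem: "f \<in> A \<Longrightarrow> g \<in> A \<Longrightarrow> (\<lambda>y. f y - g y) \<in> A"
  using add_mem[OF _ mult_mem[OF const_mem[of "-1"]], of f g] by simp

lemma sum_mem: "(\<And>i. i \<in> I \<Longrightarrow> f i \<in> A) \<Longrightarrow> (\<lambda>y. \<Sum>i\<in>I. f i y) \<in> A"
  by (induction I rule: infinite_finite_induct) (auto intro: const_mem add_mem)

lemma power_mem: "f \<in> A \<Longrightarrow> (\<lambda>y. f y ^ n) \<in> A"
  by (induction n) (auto intro: const_mem mult_mem)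

text \<open>
  The number \<open>n\<close> is a formal bound: the coefficient of \<open>X\<^bsup>n-1\<^esup>\<close> may vanish for some parameters,
  so the degree itself is not a function of the family.
\<close>

definition parametric_polys :: "nat \<Rightarrow> ('y \<Rightarrow> 'k poly) set" where
  "parametric_polys n = {P. (\<forall>i. (\<lambda>y. coeff (P y) i) \<in> A) \<and> (\<forall>y. \<forall>i\<ge>n. coeff (P y) i = 0)}"

lemma parametric_polysD:
  assumes "P \<in> parametric_polys n"
  shows "(\<lambda>y. coeff (P y) i) \<in> A" "n \<le> i \<Longrightarrow> coeff (P y) i = 0"
  using assms unfolding parametric_polys_def by blast+

lemma parametric_polys_mono: "m \<le> n \<Longrightarrow> parametric_polys m \<subseteq> parametric_polys n"
  unfolding parametric_polys_def by auto

lemma smult_parametric: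
  "a \<in> A \<Longrightarrow> P \<in> parametric_polys n \<Longrightarrow> (\<lambda>y. smult (a y) (P y)) \<in> parametric_polys n"
  unfolding parametric_polys_def by (auto intro: mult_mem)

lemma pderiv_parametric:
  assumes "P \<in> parametric_polys n"
  shows "(\<lambda>y. pderiv (P y)) \<in> parametric_polys (n - 1)"
  using assms unfolding parametric_polys_def
  by (auto simp: coeff_pderiv simp del: of_nat_Suc intro!: mult_mem[OF const_mem])

lemma truncate_parametric:
  assumes "P \<in> parametric_polys n"
  shows "(\<lambda>y. P y - monom (coeff (P y) (n - 1)) (n - 1)) \<in> parametric_polys (n - 1)"
proof -
  have "(\<lambda>y. coeff (P y - monom (coeff (P y) (n - 1)) (n - 1)) i) \<in> A" for i
  proof (cases "n - 1 = i")
    case True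
    thus ?thesis using const_mem[of 0] by simp
  next
    case False
    thus ?thesis using parametric_polysD(1)[OF assms] by simp
  qed
  moreover have "coeff (P y - monom (coeff (P y) (n - 1)) (n - 1)) i = 0" if "n - 1 \<le> i" for y i
    using parametric_polysD(2)[OF assms, of i y] that by (cases "n - 1 = i") auto
  ultimately show ?thesis unfolding parametric_polys_def by blast
qed

text \<open>
  Division without inverting the leading coefficient \<open>l\<close> of the divisor: each step multiplies
  the dividend by \<open>l\<close> before it subtracts a multiple of the divisor. The identity holds for
  every parameter, including those where \<open>l\<close> vanishes.
\<close>

lemma pseudo_remainder:
  assumes "P \<in> parametric_polys n" and R: "R \<in> parametric_polys m" and "m \<ge> 1"
  shows "\<exists>S\<in>parametric_polys (m - 1). \<exists>k. \<forall>y. \<exists>T. smult (coeff (R y) (m - 1) ^ k) (P y) = R y * T + S y"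
  using assms(1)
proof (induction n arbitrary: P)
  case 0
  hence "P \<in> parametric_polys (m - 1)" using parametric_polys_mono[of 0 "m - 1"] by auto
  thus ?case by (intro bexI[of _ P] exI[of _ 0]) (auto intro: exI[of _ 0])
next
  case (Suc n)
  show ?case
  proof (cases "Suc n \<le> m - 1")
    case True
    hence "P \<in> parametric_polys (m - 1)" using Suc.prems parametric_polys_mono by blast
    thus ?thesis by (intro bexI[of _ P] exI[of _ 0]) (auto intro: exI[of _ 0])
  next
    case False
    define d where "d = n - (m - 1)"
    define l where "l = (\<lambda>y. coeff (R y) (m - 1))"
    define P' where "P' = (\<lambda>y. smult (l y) (P y) - monom (coeff (P y) n) d * R y)"
    have lA: "l \<in> A" using parametric_polysD(1)[OF R] by (simp add: l_def)
    have c: "coeff (P' y) i = l y * coeff (P y) i - (if i < d then 0 else coeff (P y) n * coeff (R y) (i - d))" for y i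
      by (simp add: P'_def coeff_monom_mult not_less)
    have "P' \<in> parametric_polys n"
      unfolding parametric_polys_def
    proof (intro CollectI conjI allI impI)
      fix i
      show "(\<lambda>y. coeff (P' y) i) \<in> A"
        unfolding c using parametric_polysD(1)[OF Suc.prems] parametric_polysD(1)[OF R] lA
        by (cases "i < d") (auto intro!: diff_mem mult_mem const_mem)
    next
      fix y i assume i: "n \<le> i"
      show "coeff (P' y) i = 0"
      proof (cases "i = n")
        case True
        have "n - d = m - 1" using False by (simp add: d_def)
        thus ?thesis using True by (simp add: c l_def d_def)
      next
        case ne: False
        hence "coeff (P y) i = 0" "coeff (R y) (i - d) = 0"
          using i False parametric_polysD(2)[OF Suc.prems] parametric_polysD(2)[OF R] by (auto simp: d_def)
        thus ?thesis by (simp add: c)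
      qed
    qed
    from Suc.IH[OF this] obtain S k where S: "S \<in> parametric_polys (m - 1)"
      and k: "\<And>y. \<exists>T. smult (l y ^ k) (P' y) = R y * T + S y"
      unfolding l_def by blast
    have "\<exists>T. smult (l y ^ Suc k) (P y) = R y * T + S y" for y
    proof -
      obtain T where T: "smult (l y ^ k) (P' y) = R y * T + S y" using k by blast
      have "smult (l y ^ Suc k) (P y) = smult (l y ^ k) (P' y) + R y * smult (l y ^ k) (monom (coeff (P y) n) d)"
        by (simp add: P'_def algebra_simps smult_diff_right)
      also have "\<dots> = R y * (T + smult (l y ^ k) (monom (coeff (P y) n) d)) + S y"
        unfolding T by (simp add: algebra_simps)
      finally show ?thesis by blast
    qed
    thus ?thesis using S unfolding l_def by blast
  qed
qed

text \<open>
  At a root of the divisor, the remainder equals the dividend up to a power of \<open>l\<close>; multiplying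
  once more by that power makes the factor a square.
\<close>

lemma pseudo_remainder_same_sign:
  assumes "P \<in> parametric_polys n" and R: "R \<in> parametric_polys m" and "m \<ge> 1"
  shows "\<exists>S\<in>parametric_polys (m - 1). \<forall>y x. coeff (R y) (m - 1) \<noteq> 0 \<longrightarrow> poly (R y) x = 0 \<longrightarrow>
    sgn (poly (S y) x) = sgn (poly (P y) x)"
proof -
  define l where "l = (\<lambda>y. coeff (R y) (m - 1))"
  have lA: "l \<in> A" using parametric_polysD(1)[OF R] by (simp add: l_def)
  obtain S k where S: "S \<in> parametric_polys (m - 1)"
    and k: "\<And>y. \<exists>T. smult (l y ^ k) (P y) = R y * T + S y"
    using pseudo_remainder[OF assms] unfolding l_def by blast
  have "sgn (poly (smult (l y ^ k) (S y)) x) = sgn (poly (P y) x)" if "l y \<noteq> 0" "poly (R y) x = 0" for y x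
  proof -
    obtain T where "smult (l y ^ k) (P y) = R y * T + S y" using k by blast
    hence "poly (smult (l y ^ k) (P y)) x = poly (S y) x" using that by simp
    hence eq: "poly (smult (l y ^ k) (S y)) x = (l y ^ k)\<^sup>2 * poly (P y) x"
      by (simp add: power2_eq_square mult.assoc)
    have "(l y ^ k)\<^sup>2 > 0" using that by (subst zero_less_power2) simp
    hence "sgn ((l y ^ k)\<^sup>2) = 1" by (rule sgn_pos)
    thus ?thesis unfolding eq sgn_mult by (metis mult_1_left)
  qed
  moreover have "(\<lambda>y. smult (l y ^ k) (S y)) \<in> parametric_polys (m - 1)"
    using S lA by (intro smult_parametric power_mem)
  ultimately show ?thesis
    by - (rule bexI[of _ "\<lambda>y. smult (l y ^ k) (S y)"], simp_all only: l_def, blast)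
qed

text \<open>
  The finite set \<open>F\<close> is built by induction on the multiset of degree bounds. It contains the
  leading coefficients, the sets belonging to the families in which one polynomial has lost its
  leading term, and the set of the derived family, in which a polynomial with the largest bound
  has been replaced by its derivative and remainders. Two parameters at which \<open>F\<close> has the same
  signs either make the same leading coefficient vanish or make none vanish.
\<close>

lemma sign_pattern_determined:
  assumes "\<And>n P. (n, P) \<in> set ps \<Longrightarrow> P \<in> parametric_polys n"
  shows "\<exists>F. finite F \<and> F \<subseteq> A \<and> (\<forall>y y'. same_signs F y y' \<longrightarrow> same_pattern (pairs ps y y') None None)"
  using assms
proof (induction "mset (map fst ps)" arbitrary: ps rule: wfp_induct_rule[OF wfp_less_nat_multiset])
  case (1 ps)
  note IH = 1(1) and less = 1(2)
  have remove: "\<exists>qs. mset (map fst ps) = add_mset n (mset (map fst qs)) \<and> set ps = insert (n, P) (set qs)"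
    if nP: "(n, P) \<in> set ps" for n P
  proof -
    obtain xs ys where "ps = xs @ (n, P) # ys" using nP by (meson split_list)
    thus ?thesis by (intro exI[of _ "xs @ ys"]) auto
  qed
  consider "ps = []" | n P where "(n, P) \<in> set ps" "n \<le> 1"
    | "ps \<noteq> []" "\<And>n P. (n, P) \<in> set ps \<Longrightarrow> n \<ge> 2" by fastforce
  thus ?case
  proof cases
    case 1
    thus ?thesis by (intro exI[of _ "{}"]) (auto simp: pairs_def agree_def intro: same_pattern.last)
  next
    case (2 n P)
    obtain qs where qs: "mset (map fst ps) = add_mset n (mset (map fst qs))" "set ps = insert (n, P) (set qs)"
      using remove[OF 2(1)] by blast
    have "mset (map fst qs) < mset (map fst ps)"
      using multiset_replace_less[OF qs(1), of "{#}"] by simp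
    then obtain F where F: "finite F" "F \<subseteq> A"
      "\<And>y y'. same_signs F y y' \<Longrightarrow> same_pattern (pairs qs y y') None None"
      using IH[of qs] less unfolding qs(2) by blast
    have P: "P \<in> parametric_polys n" using less 2 by blast
    have const: "poly (P y) x = coeff (P y) 0" for y x
    proof -
      have "P y = [:coeff (P y) 0:]"
        using parametric_polysD(2)[OF P, of _ y] 2(2)
        by (intro poly_eqI) (auto simp: coeff_pCons split: nat.splits)
      thus ?thesis by (metis poly_pCons poly_0 mult_zero_right add_0_right)
    qed
    have "same_pattern (pairs ps y y') None None"
      if "same_signs (insert (\<lambda>y. coeff (P y) 0) F) y y'" for y y'
    proof -
      have eq: "sgn (coeff (P y) 0) = sgn (coeff (P y') 0)" and "same_signs F y y'"
        using that by (auto simp: same_signs_def)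
      hence "same_pattern (pairs qs y y') None None" using F by blast
      moreover have "agree (pairs ps y y') x x'" if "agree (pairs qs y y') x x'" for x x'
        using that eq by (simp add: pairs_def qs(2) agree_insert const)
      ultimately show ?thesis by (rule same_pattern_mono)
    qed
    moreover have "insert (\<lambda>y. coeff (P y) 0) F \<subseteq> A" using F parametric_polysD(1)[OF P] by blast
    ultimately show ?thesis using F(1) by (intro exI[of _ "insert (\<lambda>y. coeff (P y) 0) F"]) blast
  next
    case 3
    \<comment> \<open>Where a leading coefficient vanishes, the family without that coefficient decides.\<close>
    have trunc: "\<exists>F. finite F \<and> F \<subseteq> A \<and> (\<forall>y y'. same_signs F y y' \<longrightarrow>
        coeff (P y) (n - 1) = 0 \<longrightarrow> coeff (P y') (n - 1) = 0 \<longrightarrow> same_pattern (pairs ps y y') None None)"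
      if nP: "(n, P) \<in> set ps" for n P
    proof -
      obtain qs where qs: "mset (map fst ps) = add_mset n (mset (map fst qs))" "set ps = insert (n, P) (set qs)"
        using remove[OF nP] by blast
      define P' where "P' = (\<lambda>y. P y - monom (coeff (P y) (n - 1)) (n - 1))"
      define rs where "rs = (n - 1, P') # qs"
      have "mset (map fst rs) < mset (map fst ps)"
        using multiset_replace_less[OF qs(1), of "{#n - 1#}"] 3(2)[OF nP] by (simp add: rs_def)
      moreover have "P' \<in> parametric_polys (n - 1)"
        unfolding P'_def using less[OF nP] by (rule truncate_parametric)
      hence "Q \<in> parametric_polys k" if "(k, Q) \<in> set rs" for k Q
        using that less qs(2) by (auto simp: rs_def)
      ultimately obtain F where F: "finite F" "F \<subseteq> A"
        "\<And>y y'. same_signs F y y' \<Longrightarrow> same_pattern (pairs rs y y') None None"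
        using IH[of rs] by blast
      have "pairs ps y y' = pairs rs y y'" if "coeff (P y) (n - 1) = 0" "coeff (P y') (n - 1) = 0" for y y'
        using that by (simp add: pairs_def qs(2) rs_def P'_def)
      thus ?thesis using F by (intro exI[of _ F]) auto
    qed
    have "\<forall>nP\<in>set ps. \<exists>F. finite F \<and> F \<subseteq> A \<and> (\<forall>y y'. same_signs F y y' \<longrightarrow>
        coeff (snd nP y) (fst nP - 1) = 0 \<longrightarrow> coeff (snd nP y') (fst nP - 1) = 0 \<longrightarrow>
          same_pattern (pairs ps y y') None None)"
    proof
      fix nP assume nP: "nP \<in> set ps"
      show "\<exists>F. finite F \<and> F \<subseteq> A \<and> (\<forall>y y'. same_signs F y y' \<longrightarrow>
        coeff (snd nP y) (fst nP - 1) = 0 \<longrightarrow> coeff (snd nP y') (fst nP - 1) = 0 \<longrightarrow>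
          same_pattern (pairs ps y y') None None)"
        by (rule trunc) (simp add: nP)
    qed
    from bchoice[OF this] obtain FT where FT: "\<forall>nP\<in>set ps. finite (FT nP) \<and> FT nP \<subseteq> A \<and>
        (\<forall>y y'. same_signs (FT nP) y y' \<longrightarrow> coeff (snd nP y) (fst nP - 1) = 0 \<longrightarrow>
          coeff (snd nP y') (fst nP - 1) = 0 \<longrightarrow> same_pattern (pairs ps y y') None None)"
      by blast
    define N where "N = Max (fst ` set ps)"
    have "N \<in> fst ` set ps" unfolding N_def using 3(1) by (intro Max_in) auto
    then obtain P where NP: "(N, P) \<in> set ps" by force
    have Nmax: "n \<le> N" if "(n, Q) \<in> set ps" for n Q
      unfolding N_def using that by (intro Max_ge) force+
    have P: "P \<in> parametric_polys N" using less NP by blast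
    obtain qs where qs: "mset (map fst ps) = add_mset N (mset (map fst qs))" "set ps = insert (N, P) (set qs)"
      using remove[OF NP] by blast
    \<comment> \<open>The derivative is treated like the other members of the family: together with them it makes up the
    family \<open>J\<close> to which \<open>P\<close> is added in the end.\<close>
    define D where "D = (N - 1, \<lambda>y. pderiv (P y))"
    have dD: "fst D < N" "fst D \<ge> 1" using 3(2)[OF NP] by (auto simp: D_def)
    have pD: "R \<in> parametric_polys m" if "(m, R) \<in> set (D # qs)" for m R
      using that less qs(2) pderiv_parametric[OF P] by (auto simp: D_def)
    have mD: "m \<ge> 1 \<and> m \<le> N" if "(m, R) \<in> set (D # qs)" for m R
      using that 3(2)[of m R] Nmax[of m R] qs(2) dD by auto
    have "\<forall>mR\<in>set (D # qs). \<exists>S. S \<in> parametric_polys (fst mR - 1) \<and> (\<forall>y x. coeff (snd mR y) (fst mR - 1) \<noteq> 0 \<longrightarrow>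
        poly (snd mR y) x = 0 \<longrightarrow> sgn (poly (S y) x) = sgn (poly (P y) x))"
    proof
      fix mR assume mR: "mR \<in> set (D # qs)"
      hence "(fst mR, snd mR) \<in> set (D # qs)" by simp
      from pseudo_remainder_same_sign[OF P pD[OF this]] mD[OF this]
      show "\<exists>S. S \<in> parametric_polys (fst mR - 1) \<and> (\<forall>y x. coeff (snd mR y) (fst mR - 1) \<noteq> 0 \<longrightarrow>
        poly (snd mR y) x = 0 \<longrightarrow> sgn (poly (S y) x) = sgn (poly (P y) x))" by blast
    qed
    from bchoice[OF this] obtain S where S0: "\<forall>mR\<in>set (D # qs). S mR \<in> parametric_polys (fst mR - 1) \<and>
        (\<forall>y x. coeff (snd mR y) (fst mR - 1) \<noteq> 0 \<longrightarrow> poly (snd mR y) x = 0 \<longrightarrow>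
          sgn (poly (S mR y) x) = sgn (poly (P y) x))" by blast
    have S: "S (m, R) \<in> parametric_polys (m - 1)"
      "coeff (R y) (m - 1) \<noteq> 0 \<Longrightarrow> poly (R y) x = 0 \<Longrightarrow> sgn (poly (S (m, R) y) x) = sgn (poly (P y) x)"
      if "(m, R) \<in> set (D # qs)" for m R y x
      using bspec[OF S0 that] by simp_all
    define rems where "rems = map (\<lambda>mR. (fst mR - 1, S mR)) (D # qs)"
    define rs where "rs = qs @ (D # rems)"
    have "mset (map fst rs) = mset (map fst qs) + mset (map fst (D # rems))" by (simp add: rs_def)
    moreover have "k < N" if "k \<in># mset (map fst (D # rems))" for k
      using that dD mD by (force simp: rems_def)
    ultimately have "mset (map fst rs) < mset (map fst ps)"
      using multiset_replace_less[OF qs(1)] by metis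
    moreover have "Q \<in> parametric_polys k" if "(k, Q) \<in> set rs" for k Q
      using that pD S0 by (auto simp: rs_def rems_def)
    ultimately obtain FD where FD: "finite FD" "FD \<subseteq> A"
        "\<And>y y'. same_signs FD y y' \<Longrightarrow> same_pattern (pairs rs y y') None None"
      using IH[of rs] by blast
    define FL where "FL = (\<lambda>(n, P) y. coeff (P y) (n - 1)) ` set ps"
    define F where "F = FL \<union> (\<Union>nP\<in>set ps. FT nP) \<union> FD"
    have "finite F" unfolding F_def FL_def using FT FD by auto
    moreover have "F \<subseteq> A" unfolding F_def FL_def
      using FT FD parametric_polysD(1)[OF less] by fastforce
    moreover have "same_pattern (pairs ps y y') None None" if F: "same_signs F y y'" for y y'
    proof (cases "\<exists>n P. (n, P) \<in> set ps \<and> coeff (P y) (n - 1) = 0")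
      case True
      then obtain n P where nP: "(n, P) \<in> set ps" "coeff (P y) (n - 1) = 0" by blast
      have "(\<lambda>y. coeff (P y) (n - 1)) \<in> F" using nP unfolding F_def FL_def by force
      hence "sgn (coeff (P y) (n - 1)) = sgn (coeff (P y') (n - 1))" using F by (auto simp: same_signs_def)
      hence "coeff (P y') (n - 1) = 0" using nP by (simp add: sgn_0_0)
      moreover have "same_signs (FT (n, P)) y y'" using F nP by (auto simp: same_signs_def F_def)
      ultimately show ?thesis using bspec[OF FT nP(1)] nP(2) by simp
    next
      case False
      have lc: "coeff (Q y) (n - 1) \<noteq> 0 \<and> coeff (Q y') (n - 1) \<noteq> 0" if nQ: "(n, Q) \<in> set ps" for n Q
      proof -
        have "(\<lambda>y. coeff (Q y) (n - 1)) \<in> F" using nQ unfolding F_def FL_def by force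
        hence "sgn (coeff (Q y) (n - 1)) = sgn (coeff (Q y') (n - 1))" using F by (auto simp: same_signs_def)
        thus ?thesis using False nQ by (auto simp: sgn_0_0 dest: sym)
      qed
      have lcD: "coeff (R y) (m - 1) \<noteq> 0 \<and> coeff (R y') (m - 1) \<noteq> 0" if mR: "(m, R) \<in> set (D # qs)" for m R
      proof (cases "(m, R) = D")
        case True
        have "Suc (N - 2) = N - 1" using 3(2)[OF NP] by simp
        thus ?thesis using True lc[OF NP] by (auto simp: D_def coeff_pderiv numeral_2_eq_2 simp del: of_nat_Suc)
      next
        case False
        thus ?thesis using lc[of m R] mR qs(2) by auto
      qed
      define J where "J = pairs (D # qs) y y'"
      have pat: "same_pattern (pairs rs y y') None None" using F FD(3) by (auto simp: same_signs_def F_def)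
      have "same_pattern (insert (P y, P y') J) None None"
      proof (rule same_pattern_insert[OF pat])
        show "J \<subseteq> pairs rs y y'" unfolding J_def pairs_def rs_def by auto
        show "f \<noteq> 0 \<and> g \<noteq> 0" if "(f, g) \<in> J" for f g
          using that lcD unfolding J_def pairs_def by fastforce
        show "(pderiv (P y), pderiv (P y')) \<in> J" unfolding J_def pairs_def D_def by simp
        show "sgn (poly (P y) z) = sgn (poly (P y') z')"
          if fg: "(f, g) \<in> J" and ag: "agree (pairs rs y y') z z'" and z: "poly f z = 0" for f g z z'
        proof -
          obtain mR where mR0: "mR \<in> set (D # qs)" "(f, g) = (\<lambda>(n, P). (P y, P y')) mR"
            using fg unfolding J_def pairs_def by blast
          obtain m R where "mR = (m, R)" by (cases mR)
          hence mR: "(m, R) \<in> set (D # qs)" "f = R y" "g = R y'" using mR0 by simp_all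
          have "(f, g) \<in> pairs rs y y'" "(S (m, R) y, S (m, R) y') \<in> pairs rs y y'"
            using mR unfolding pairs_def rs_def rems_def by force+
          hence eqs: "sgn (poly f z) = sgn (poly g z')" "sgn (poly (S (m, R) y) z) = sgn (poly (S (m, R) y') z')"
            using ag by (auto simp: agree_def)
          hence "poly g z' = 0" using z by (simp add: sgn_0_0)
          thus ?thesis using S(2)[OF mR(1)] lcD[OF mR(1)] z mR eqs(2) by metis
        qed
      qed
      moreover have "pairs ps y y' \<subseteq> insert (P y, P y') J"
        unfolding J_def pairs_def qs(2) by auto
      ultimately show ?thesis by (metis agree_subset same_pattern_mono)
    qed
    ultimately show ?thesis by blast
  qed
qed

lemma const_parametric:
  assumes "f \<in> A"
  shows "(\<lambda>y. [:f y:]) \<in> parametric_polys 1"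
  unfolding parametric_polys_def
proof (intro CollectI conjI allI impI)
  show "(\<lambda>y. coeff [:f y:] i) \<in> A" for i
    by (cases i) (use assms const_mem[of 0] in simp_all)
qed (auto simp: coeff_pCons split: nat.splits)

lemma add_parametric:
  assumes "P \<in> parametric_polys m" "Q \<in> parametric_polys n"
  shows "(\<lambda>y. P y + Q y) \<in> parametric_polys (max m n)"
  using assms unfolding parametric_polys_def by (auto intro: add_mem)

lemma mult_parametric:
  assumes P: "P \<in> parametric_polys m" and Q: "Q \<in> parametric_polys n"
  shows "(\<lambda>y. P y * Q y) \<in> parametric_polys (m + n)"
  unfolding parametric_polys_def
proof (intro CollectI conjI allI impI)
  show "(\<lambda>y. coeff (P y * Q y) i) \<in> A" for i
    unfolding coeff_mult by (intro sum_mem mult_mem parametric_polysD(1)[OF P] parametric_polysD(1)[OF Q])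
next
  fix y i assume "m + n \<le> i"
  hence "coeff (P y) j * coeff (Q y) (i - j) = 0" if "j \<le> i" for j
    using parametric_polysD(2)[OF P, of j y] parametric_polysD(2)[OF Q, of "i - j" y] that
    by (cases "m \<le> j") auto
  thus "coeff (P y * Q y) i = 0" unfolding coeff_mult by (intro sum.neutral ballI) simp
qed

end

section \<open>Definable predicates and quantifier elimination\<close>

text \<open>
  Points of \<open>K\<^sup>n\<close> and auxiliary variables are both read from an environment \<open>e\<close>, a function on
  all of \<^typ>\<open>nat\<close>; the variables outside \<open>{1..n}\<close> are available for bounds that are quantified
  later.
\<close>

inductive_set polynomial_functions :: "((nat \<Rightarrow> 'k::real_closed_field) \<Rightarrow> 'k) set" where
  const: "(\<lambda>_. c) \<in> polynomial_functions"
| var: "(\<lambda>e. e i) \<in> polynomial_functions"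
| add: "f \<in> polynomial_functions \<Longrightarrow> g \<in> polynomial_functions \<Longrightarrow> (\<lambda>e. f e + g e) \<in> polynomial_functions"
| mult: "f \<in> polynomial_functions \<Longrightarrow> g \<in> polynomial_functions \<Longrightarrow> (\<lambda>e. f e * g e) \<in> polynomial_functions"

definition polynomial_functions_without :: "nat \<Rightarrow> ((nat \<Rightarrow> 'k::real_closed_field) \<Rightarrow> 'k) set" where
  "polynomial_functions_without i = {f \<in> polynomial_functions. \<forall>e a. f (e(i := a)) = f e}"

interpretation polynomial_functions: function_ring polynomial_functions
  by standard (auto intro: polynomial_functions.intros)

interpretation polynomial_functions_without: function_ring "polynomial_functions_without i" for i
  by standard (auto simp: polynomial_functions_without_def intro: polynomial_functions.intros)

lemma polynomial_function_in_variable: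
  assumes "f \<in> polynomial_functions"
  shows "\<exists>n. \<exists>p\<in>polynomial_functions_without.parametric_polys i n. \<forall>e a. f (e(i := a)) = poly (p e) a"
  using assms
proof induction
  case (const c)
  have "(\<lambda>_. [:c:]) \<in> polynomial_functions_without.parametric_polys i 1"
    by (intro polynomial_functions_without.const_parametric polynomial_functions_without.const_mem)
  thus ?case by (intro exI[of _ 1] bexI[of _ "\<lambda>_. [:c:]"]) auto
next
  case (var j)
  show ?case
  proof (cases "j = i")
    case True
    have "(\<lambda>_. [:0, 1:]) \<in> polynomial_functions_without.parametric_polys i 2"
      unfolding polynomial_functions_without.parametric_polys_def
      by (auto simp: coeff_pCons polynomial_functions_without.const_mem split: nat.splits)
    thus ?thesis using True by (intro exI[of _ 2] bexI[of _ "\<lambda>_. [:0, 1:]"]) auto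
  next
    case False
    have "(\<lambda>e. e j) \<in> polynomial_functions_without i"
      using False by (auto simp: polynomial_functions_without_def intro: polynomial_functions.var)
    hence "(\<lambda>e. [:e j:]) \<in> polynomial_functions_without.parametric_polys i 1"
      by (rule polynomial_functions_without.const_parametric)
    thus ?thesis using False by (intro exI[of _ 1] bexI[of _ "\<lambda>e. [:e j:]"]) auto
  qed
next
  case (add f g)
  then obtain m n p q where pq:
    "p \<in> polynomial_functions_without.parametric_polys i m" "\<And>e a. f (e(i := a)) = poly (p e) a"
    "q \<in> polynomial_functions_without.parametric_polys i n" "\<And>e a. g (e(i := a)) = poly (q e) a" by blast
  show ?case
    by (intro exI[of _ "max m n"] bexI[OF _ polynomial_functions_without.add_parametric[OF pq(1,3)]])
      (intro allI, simp only: pq(2,4) poly_add)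
next
  case (mult f g)
  then obtain m n p q where pq:
    "p \<in> polynomial_functions_without.parametric_polys i m" "\<And>e a. f (e(i := a)) = poly (p e) a"
    "q \<in> polynomial_functions_without.parametric_polys i n" "\<And>e a. g (e(i := a)) = poly (q e) a" by blast
  show ?case
    by (intro exI[of _ "m + n"] bexI[OF _ polynomial_functions_without.mult_parametric[OF pq(1,3)]])
      (intro allI, simp only: pq(2,4) poly_mult)
qed

text \<open>
  Prescribing the signs of the functions in \<open>F\<close> cuts the space of environments into finitely
  many pieces, and \<open>P\<close> is a union of some of them; so these are the semialgebraic predicates,
  described without formulas. The implication in the other direction follows by symmetry of
  \<^const>\<open>same_signs\<close>.
\<close>

definition definable :: "((nat \<Rightarrow> 'k::real_closed_field) \<Rightarrow> bool) \<Rightarrow> bool" where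
  "definable P \<longleftrightarrow> (\<exists>F. finite F \<and> F \<subseteq> polynomial_functions \<and> (\<forall>e e'. same_signs F e e' \<longrightarrow> P e \<longrightarrow> P e'))"

lemma definableI:
  "finite F \<Longrightarrow> F \<subseteq> polynomial_functions \<Longrightarrow> (\<And>e e'. same_signs F e e' \<Longrightarrow> P e \<Longrightarrow> P e') \<Longrightarrow> definable P"
  unfolding definable_def by blast

lemma same_signs_sym: "same_signs F e e' \<Longrightarrow> same_signs F e' e"
  by (simp add: same_signs_def)

lemma same_signs_Un: "same_signs (F \<union> G) e e' \<longleftrightarrow> same_signs F e e' \<and> same_signs G e e'"
  by (auto simp: same_signs_def)

lemma definable_not: assumes "definable P" shows "definable (\<lambda>e. \<not> P e)"
proof -
  obtain F where "finite F" "F \<subseteq> polynomial_functions" "\<And>e e'. same_signs F e e' \<Longrightarrow> P e \<Longrightarrow> P e'"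
    using assms unfolding definable_def by blast
  thus ?thesis by (intro definableI[of F]) (auto dest: same_signs_sym)
qed

lemma definable_conj: assumes "definable P" "definable Q" shows "definable (\<lambda>e. P e \<and> Q e)"
proof -
  obtain F where "finite F" "F \<subseteq> polynomial_functions" "\<And>e e'. same_signs F e e' \<Longrightarrow> P e \<Longrightarrow> P e'"
    using assms(1) unfolding definable_def by blast
  moreover obtain G where "finite G" "G \<subseteq> polynomial_functions" "\<And>e e'. same_signs G e e' \<Longrightarrow> Q e \<Longrightarrow> Q e'"
    using assms(2) unfolding definable_def by blast
  ultimately show ?thesis by (intro definableI[of "F \<union> G"]) (auto simp: same_signs_Un)
qed

lemma definable_disj: assumes "definable P" "definable Q" shows "definable (\<lambda>e. P e \<or> Q e)"
  using definable_not[OF definable_conj[OF definable_not[OF assms(1)] definable_not[OF assms(2)]]] by simp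

lemma definable_imp: assumes "definable P" "definable Q" shows "definable (\<lambda>e. P e \<longrightarrow> Q e)"
  unfolding imp_conv_disj by (intro definable_disj definable_not assms)

lemma definable_const: "definable (\<lambda>_. b)"
  by (rule definableI[of "{}"]) auto

lemma definable_ball:
  assumes "finite I" "\<And>i. i \<in> I \<Longrightarrow> definable (P i)"
  shows "definable (\<lambda>e. \<forall>i\<in>I. P i e)"
  using assms by (induction I) (auto intro: definable_const definable_conj)

lemma definable_bex:
  assumes "finite I" "\<And>i. i \<in> I \<Longrightarrow> definable (P i)"
  shows "definable (\<lambda>e. \<exists>i\<in>I. P i e)"
  using assms by (induction I) (auto intro: definable_const definable_disj)

lemma definable_pos: assumes "f \<in> polynomial_functions" shows "definable (\<lambda>e. f e > 0)"
proof (rule definableI[of "{f}"])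
  fix e e' assume "same_signs {f} e e'" "f e > 0"
  hence "sgn (f e') = 1" by (simp add: same_signs_def)
  thus "f e' > 0" by (simp add: sgn_1_pos)
qed (use assms in auto)

lemma definable_zero: assumes "f \<in> polynomial_functions" shows "definable (\<lambda>e. f e = 0)"
proof (rule definableI[of "{f}"])
  fix e e' assume "same_signs {f} e e'" "f e = 0"
  hence "sgn (f e') = 0" by (simp add: same_signs_def)
  thus "f e' = 0" by (simp add: sgn_0_0)
qed (use assms in auto)

lemma definable_le:
  assumes "f \<in> polynomial_functions" "g \<in> polynomial_functions"
  shows "definable (\<lambda>e. f e \<le> g e)"
  using definable_not[OF definable_pos[OF polynomial_functions.diff_mem[OF assms]]] by (simp add: not_less)

lemma definable_abs_le:
  assumes "f \<in> polynomial_functions" "g \<in> polynomial_functions"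
  shows "definable (\<lambda>e. \<bar>f e\<bar> \<le> g e)"
proof -
  have "(\<lambda>e. - f e) \<in> polynomial_functions"
    using polynomial_functions.diff_mem[OF polynomial_functions.const_mem[of 0] assms(1)] by simp
  thus ?thesis using definable_conj[OF definable_le[OF assms] definable_le[OF _ assms(2)]]
    by (simp add: abs_le_iff)
qed

lemma definable_le_abs:
  assumes "f \<in> polynomial_functions" "g \<in> polynomial_functions"
  shows "definable (\<lambda>e. f e \<le> \<bar>g e\<bar>)"
proof -
  have "(\<lambda>e. - g e) \<in> polynomial_functions"
    using polynomial_functions.diff_mem[OF polynomial_functions.const_mem[of 0] assms(2)] by simp
  hence "definable (\<lambda>e. f e \<le> g e \<or> f e \<le> - g e)"
    using assms by (intro definable_disj definable_le)
  moreover have "(\<lambda>e. f e \<le> g e \<or> f e \<le> - g e) = (\<lambda>e. f e \<le> \<bar>g e\<bar>)" by (auto simp: abs_if fun_eq_iff)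
  ultimately show ?thesis by simp
qed

lemma polynomial_functions_in_variable:
  assumes "F \<subseteq> polynomial_functions"
  shows "\<exists>np. \<forall>f\<in>F. snd (np f) \<in> polynomial_functions_without.parametric_polys i (fst (np f)) \<and>
    (\<forall>e a. f (e(i := a)) = poly (snd (np f) e) a)"
proof (rule bchoice, rule ballI)
  fix f assume "f \<in> F"
  then obtain n p where "p \<in> polynomial_functions_without.parametric_polys i n"
    "\<forall>e a. f (e(i := a)) = poly (p e) a"
    using polynomial_function_in_variable[of f i] assms by blast
  thus "\<exists>np. snd np \<in> polynomial_functions_without.parametric_polys i (fst np) \<and>
      (\<forall>e a. f (e(i := a)) = poly (snd np e) a)"
    by (intro exI[of _ "(n, p)"]) simp
qed

text \<open>
  Tarski--Seidenberg. If the signs of \<open>G\<close> agree at \<open>e\<close> and \<open>e'\<close>, then the polynomials in the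
  variable \<open>i\<close> obtained from \<open>F\<close> have the same pattern at \<open>e\<close> and \<open>e'\<close>, so a witness for \<open>e\<close> has
  a counterpart for \<open>e'\<close>.
\<close>

theorem definable_exists:
  assumes "definable P"
  shows "definable (\<lambda>e. \<exists>a. P (e(i := a)))"
proof -
  obtain F where F: "finite F" "F \<subseteq> polynomial_functions" "\<And>e e'. same_signs F e e' \<Longrightarrow> P e \<Longrightarrow> P e'"
    using assms unfolding definable_def by blast
  obtain np where np: "\<forall>f\<in>F. snd (np f) \<in> polynomial_functions_without.parametric_polys i (fst (np f)) \<and>
      (\<forall>e a. f (e(i := a)) = poly (snd (np f) e) a)"
    using polynomial_functions_in_variable[OF F(2), of i] by blast
  define p where "p = (\<lambda>f. snd (np f))"
  define n where "n = (\<lambda>f. fst (np f))"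
  have p: "p f \<in> polynomial_functions_without.parametric_polys i (n f)"
    "f (e(i := a)) = poly (p f e) a" if "f \<in> F" for f e a
    using bspec[OF np that] by (simp_all only: p_def n_def)
  obtain fs where fs: "set fs = F" using F(1) finite_list by blast
  define ps where "ps = map (\<lambda>f. (n f, p f)) fs"
  have ps: "Q \<in> polynomial_functions_without.parametric_polys i m" if "(m, Q) \<in> set ps" for m Q
    using that p(1) fs by (auto simp: ps_def)
  have "\<exists>G. finite G \<and> G \<subseteq> polynomial_functions_without i \<and>
      (\<forall>e e'. same_signs G e e' \<longrightarrow> same_pattern (pairs ps e e') None None)"
    by (rule polynomial_functions_without.sign_pattern_determined) (rule ps)
  then obtain G where G: "finite G" "G \<subseteq> polynomial_functions_without i"
    "\<forall>e e'. same_signs G e e' \<longrightarrow> same_pattern (pairs ps e e') None None" by (elim exE conjE)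
  show ?thesis
  proof (rule definableI[OF G(1)])
    show "G \<subseteq> polynomial_functions" using G(2) by (auto simp: polynomial_functions_without_def)
    fix e e' assume ee: "same_signs G e e'" and "\<exists>a. P (e(i := a))"
    then obtain a where a: "P (e(i := a))" by blast
    obtain a' where a': "agree (pairs ps e e') a a'"
      using same_pattern_transfers_points[OF G(3)[rule_format, OF ee], of a] by (auto simp: between_def)
    have "same_signs F (e(i := a)) (e'(i := a'))"
      unfolding same_signs_def
    proof
      fix f assume f: "f \<in> F"
      hence "(p f e, p f e') \<in> pairs ps e e'" unfolding pairs_def ps_def using fs by force
      thus "sgn (f (e(i := a))) = sgn (f (e'(i := a')))" using a' f p(2) by (auto simp: agree_def)
    qed
    thus "\<exists>a. P (e'(i := a))" using F(3) a by blast
  qed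
qed

lemma definable_exists_many:
  assumes "finite I" "definable P"
  shows "definable (\<lambda>e. \<exists>x. P (override_on e x I))"
  using assms
proof (induction I)
  case (insert i I)
  have eq: "(\<exists>x. P (override_on e x (insert i I))) \<longleftrightarrow> (\<exists>a x. P (override_on (e(i := a)) x I))" for e
  proof
    assume "\<exists>x. P (override_on e x (insert i I))"
    then obtain x where "P (override_on e x (insert i I))" by blast
    moreover have "override_on e x (insert i I) = override_on (e(i := x i)) x I"
      using insert.hyps by (auto simp: override_on_def fun_eq_iff)
    ultimately show "\<exists>a x. P (override_on (e(i := a)) x I)" by auto
  next
    assume "\<exists>a x. P (override_on (e(i := a)) x I)"
    then obtain a x where "P (override_on (e(i := a)) x I)" by blast
    moreover have "override_on (e(i := a)) x I = override_on e (x(i := a)) (insert i I)"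
      using insert.hyps by (auto simp: override_on_def fun_eq_iff)
    ultimately show "\<exists>x. P (override_on e x (insert i I))" by auto
  qed
  show ?case unfolding eq by (rule definable_exists) (use insert in blast)
qed simp

text \<open>
  A definable subset of the line can change its truth value only at one of finitely many points,
  the roots of the polynomials that determine it. If there were no least upper bound, one could
  choose an element \<open>l\<close> of the set and an upper bound \<open>u\<close> with none of these points in between,
  and then \<open>u\<close> would belong to the set.
\<close>

theorem definable_supremum:
  fixes P :: "(nat \<Rightarrow> 'k::real_closed_field) \<Rightarrow> bool"
  assumes "definable P" and ne: "P (e(i := a0))" and bdd: "\<And>a. P (e(i := a)) \<Longrightarrow> a \<le> b0"
  obtains s where "\<And>a. P (e(i := a)) \<Longrightarrow> a \<le> s" "\<And>u. (\<And>a. P (e(i := a)) \<Longrightarrow> a \<le> u) \<Longrightarrow> s \<le> u"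
proof -
  obtain F where F: "finite F" "F \<subseteq> polynomial_functions" "\<And>e e'. same_signs F e e' \<Longrightarrow> P e \<Longrightarrow> P e'"
    using assms(1) unfolding definable_def by blast
  obtain np where np: "\<forall>f\<in>F. snd (np f) \<in> polynomial_functions_without.parametric_polys i (fst (np f)) \<and>
      (\<forall>e a. f (e(i := a)) = poly (snd (np f) e) a)"
    using polynomial_functions_in_variable[OF F(2), of i] by blast
  define p where "p = (\<lambda>f. snd (np f))"
  define n where "n = (\<lambda>f. fst (np f))"
  have p: "p f \<in> polynomial_functions_without.parametric_polys i (n f)"
    "f (e(i := a)) = poly (p f e) a" if "f \<in> F" for f e a
    using bspec[OF np that] by (simp_all only: p_def n_def)
  define Z where "Z = (\<Union>f\<in>{f\<in>F. p f e \<noteq> 0}. {x. poly (p f e) x = 0})"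
  have finZ: "finite Z" unfolding Z_def using F(1) by (auto intro: poly_roots_finite)
  have const: "P (e(i := l)) \<Longrightarrow> P (e(i := u))" if lu: "l \<le> u" "\<And>z. l \<le> z \<Longrightarrow> z \<le> u \<Longrightarrow> z \<notin> Z" for l u
  proof (erule F(3)[rotated])
    show "same_signs F (e(i := l)) (e(i := u))"
      unfolding same_signs_def
    proof
      fix f assume f: "f \<in> F"
      have "sgn (poly (p f e) l) = sgn (poly (p f e) u)"
      proof (cases "p f e = 0")
        case False
        thus ?thesis using lu f by (intro no_root_imp_same_sign) (auto simp: Z_def)
      qed simp
      thus "sgn (f (e(i := l))) = sgn (f (e(i := u)))" using p(2)[OF f] by simp
    qed
  qed
  define U where "U = {u. \<forall>a. P (e(i := a)) \<longrightarrow> a \<le> u}"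
  have "\<exists>s\<in>U. \<forall>u\<in>U. s \<le> u"
  proof (rule ccontr)
    assume no: "\<not> (\<exists>s\<in>U. \<forall>u\<in>U. s \<le> u)"
    have "b0 \<in> U" using bdd by (simp add: U_def)
    \<comment> \<open>an upper bound below all the exceptional points that are upper bounds\<close>
    have "\<exists>u\<in>U. \<forall>z\<in>Y. z \<in> U \<longrightarrow> u < z" if "finite Y" for Y
      using that
    proof (induction Y)
      case empty
      thus ?case using \<open>b0 \<in> U\<close> by blast
    next
      case (insert z Y)
      then obtain u where u: "u \<in> U" "\<forall>z\<in>Y. z \<in> U \<longrightarrow> u < z" by blast
      show ?case
      proof (cases "z \<in> U")
        case True
        then obtain w where w: "w \<in> U" "w < z" using no by (meson not_le)
        show ?thesis using u w by (intro bexI[of _ "min u w"]) (auto simp: min_def)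
      next
        case False
        thus ?thesis using u by (intro bexI[of _ u]) auto
      qed
    qed
    from this[OF finZ] obtain u where u: "u \<in> U" "\<And>z. z \<in> Z \<Longrightarrow> z \<in> U \<Longrightarrow> u < z" by blast
    have "\<exists>l. P (e(i := l)) \<and> (\<forall>z\<in>Y. z \<notin> U \<longrightarrow> z < l)" if "finite Y" for Y
      using that
    proof (induction Y)
      case empty
      thus ?case using ne by blast
    next
      case (insert z Y)
      then obtain l where l: "P (e(i := l))" "\<forall>z\<in>Y. z \<notin> U \<longrightarrow> z < l" by blast
      show ?case
      proof (cases "z \<in> U")
        case True
        thus ?thesis using l by blast
      next
        case False
        then obtain m where m: "P (e(i := m))" "z < m" by (auto simp: U_def not_le)
        show ?thesis
        proof (cases "l \<le> m")
          case True
          hence "\<forall>y\<in>insert z Y. y \<notin> U \<longrightarrow> y < m" using l(2) m(2) by force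
          thus ?thesis using m(1) by blast
        next
          case False
          hence "\<forall>y\<in>insert z Y. y \<notin> U \<longrightarrow> y < l" using l(2) m(2) by force
          thus ?thesis using l(1) by blast
        qed
      qed
    qed
    from this[OF finZ] obtain l where l: "P (e(i := l))" "\<And>z. z \<in> Z \<Longrightarrow> z \<notin> U \<Longrightarrow> z < l" by blast
    obtain w where w: "w \<in> U" "w < u" using no u(1) by (meson not_le)
    have "l \<le> u" using u(1) l(1) by (simp add: U_def)
    hence "P (e(i := u))" using const[of l u] l u by (meson not_le)
    thus False using w by (force simp: U_def)
  qed
  thus ?thesis using that unfolding U_def by blast
qed

section \<open>Valuations and definable predicates\<close>

lemma polynomial_function_prod:
  "(\<And>i. i \<in> I \<Longrightarrow> f i \<in> polynomial_functions) \<Longrightarrow> (\<lambda>e. \<Prod>i\<in>I. f i e) \<in> polynomial_functions"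
  by (induction I rule: infinite_finite_induct) (auto intro: polynomial_functions.intros)

lemma mpeval_polynomial_function: "mpeval P \<in> polynomial_functions"
proof -
  have "(\<lambda>x. \<Sum>m\<in>Poly_Mapping.keys P. Poly_Mapping.lookup P m *
      (\<Prod>i\<in>Poly_Mapping.keys m. x i ^ Poly_Mapping.lookup m i)) \<in> polynomial_functions"
    by (intro polynomial_functions.sum_mem polynomial_functions.mult_mem polynomial_functions.const_mem
      polynomial_function_prod polynomial_functions.power_mem polynomial_functions.var)
  thus ?thesis unfolding mpeval_def .
qed

lemma mpeval_cong:
  assumes "P \<in> mpolynomials n" "\<And>i. i \<in> {1..n} \<Longrightarrow> x i = y i"
  shows "mpeval P x = mpeval P y"
  unfolding mpeval_def using assms unfolding mpolynomials_def
  by (intro sum.cong prod.cong arg_cong2[where f = "(*)"] refl arg_cong2[where f = "(^)"]) blast+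

lemma semialgebraic_definable:
  assumes "semialgebraic n S"
  shows "definable (\<lambda>e. restrict e {1..n} \<in> S)"
proof -
  have basic: "definable (\<lambda>e. restrict e {1..n} \<in> B)" if "basic_semialgebraic n B" for B :: "(nat \<Rightarrow> 'k::real_closed_field) set"
  proof -
    from that obtain P :: "nat \<Rightarrow> 'k mpolynomial" and p q where P: "p \<le> q" "\<forall>i\<in>{1..q}. P i \<in> mpolynomials n"
      "B = {x \<in> cart_power {1..n}.
               (\<forall>i\<in>{1..p}. mpeval (P i) x > 0) \<and> (\<forall>i\<in>{p+1..q}. mpeval (P i) x = 0)}"
      unfolding basic_semialgebraic_def by (elim exE conjE)
    have r: "mpeval (P i) (restrict e {1..n}) = mpeval (P i) e" if "i \<in> {1..q}" for i e
      by (rule mpeval_cong[of _ n]) (use P that in auto)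
    have "restrict e {1..n} \<in> B \<longleftrightarrow> (\<forall>i\<in>{1..p}. mpeval (P i) e > 0) \<and> (\<forall>i\<in>{p+1..q}. mpeval (P i) e = 0)" for e
      unfolding P(3) using r[of _ e] P(1) by auto
    moreover have "definable (\<lambda>e. (\<forall>i\<in>{1..p}. mpeval (P i) e > 0) \<and> (\<forall>i\<in>{p+1..q}. mpeval (P i) e = 0))"
      by (intro definable_conj definable_ball definable_pos definable_zero mpeval_polynomial_function) auto
    ultimately show ?thesis by simp
  qed
  obtain \<B> where B: "finite \<B>" "\<forall>B\<in>\<B>. basic_semialgebraic n B" "S = \<Union>\<B>"
    using assms unfolding semialgebraic_def by blast
  have "definable (\<lambda>e. \<exists>B\<in>\<B>. restrict e {1..n} \<in> B)"
    using B basic by (intro definable_bex) auto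
  thus ?thesis by (simp add: B(3))
qed

context
  fixes v :: "'k::real_closed_field \<Rightarrow> 'g::linordered_ab_group_add option"
  assumes convex: "convex_valuation v"
begin

lemma val_mult: "v (x * y) = v x + v y"
  and val_eq_None_iff: "v x = None \<longleftrightarrow> x = 0"
  and val_surj: "\<exists>x. v x = g"
  and val_add_le: "v (x + y) \<le> max (v x) (v y)"
proof -
  have "valuation v" using convex by (simp add: convex_valuation_def)
  note val = this[unfolded valuation_def]
  show "\<exists>x. v x = g" using val[THEN conjunct1] by (metis surjD)
  show "v x = None \<longleftrightarrow> x = 0" by (rule val[THEN conjunct2, THEN conjunct1, rule_format])
  show "v (x * y) = v x + v y" by (rule val[THEN conjunct2, THEN conjunct2, THEN conjunct1, rule_format])
  show "v (x + y) \<le> max (v x) (v y)" by (rule val[THEN conjunct2, THEN conjunct2, THEN conjunct2, rule_format])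
qed

lemma val_Some: "x \<noteq> 0 \<Longrightarrow> \<exists>g. v x = Some g"
  using val_eq_None_iff by blast

lemma val_mult_Some: "v x = Some g \<Longrightarrow> v y = Some h \<Longrightarrow> v (x * y) = Some (g + h)"
  by (simp add: val_mult plus_option_def)

lemma val_one: "v 1 = Some 0"
proof -
  obtain g where "v 1 = Some g" using val_Some[of 1] by auto
  thus ?thesis using val_mult_Some[of 1 g 1 g] by simp
qed

lemma val_minus: "v (- x) = v x"
proof -
  obtain g where g: "v (- 1) = Some g" using val_Some[of "-1"] by auto
  hence "g + g = 0" using val_mult_Some[of "-1" g "-1" g] val_one by simp
  hence "v (- 1) = Some 0" using g by simp
  hence "v (- 1 * x) = Some 0 + v x" by (simp only: val_mult)
  thus ?thesis by (cases "v x") (simp_all add: plus_option_def)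
qed

lemma val_abs: "v \<bar>x\<bar> = v x"
  by (simp add: abs_if val_minus)

text \<open>
  For \<open>y \<noteq> 0\<close> this is convexity applied to \<open>0 \<le> |x / y| \<le> 1\<close>, multiplied by \<open>y\<close>.
\<close>

lemma val_mono: assumes "\<bar>x\<bar> \<le> \<bar>y\<bar>" shows "v x \<le> v y"
proof (cases "y = 0")
  case True
  thus ?thesis using assms by simp
next
  case False
  have "1 \<in> valuation_ring v" by (simp add: valuation_ring_def val_one)
  moreover have "0 \<le> \<bar>x / y\<bar> \<and> \<bar>x / y\<bar> \<le> 1" using assms False by (simp add: field_simps)
  ultimately have "\<bar>x / y\<bar> \<in> valuation_ring v" using convex unfolding convex_valuation_def by blast
  hence le: "v (x / y) \<le> Some 0" unfolding valuation_ring_def by (simp only: mem_Collect_eq val_abs)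
  obtain h where h: "v y = Some h" using val_Some[OF False] by blast
  have "v x = v (x / y) + v y" using val_mult[of "x / y" y] False by simp
  also have "\<dots> \<le> v y" using le h by (cases "v (x / y)") (auto simp: plus_option_def)
  finally show ?thesis .
qed

lemma val_less_imp_abs_less: "v x < v y \<Longrightarrow> \<bar>x\<bar> < \<bar>y\<bar>"
  using val_mono[of y x] by (meson not_le)

lemma positive_with_val: "\<exists>x>0. v x = Some g"
proof -
  obtain x where x: "v x = Some g" using val_surj[of "Some g"] by (elim exE)
  hence "x \<noteq> 0" by (metis val_eq_None_iff option.distinct(1))
  thus ?thesis using x by (intro exI[of _ "\<bar>x\<bar>"]) (simp add: val_abs)
qed

text \<open>
  The cut between the elements of nonpositive and of positive value is not definable: if a
  definable set \<open>R\<close> consisted of all \<open>s > 0\<close> with \<open>val(s) \<le> 0\<close>, then its supremum \<open>s\<close> could not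
  lie in \<open>R\<close> because of \<open>s + 1\<close>, nor outside because of \<open>s / 2\<close>.
\<close>

lemma definable_meets_valuation_ring:
  assumes P: "definable P" and nontriv: "(UNIV :: 'g set) \<noteq> {0}"
    and large: "\<And>s. s > 0 \<Longrightarrow> v s > Some 0 \<Longrightarrow> P (e(i := s))"
  shows "\<exists>s>0. v s \<le> Some 0 \<and> P (e(i := s))"
proof (rule ccontr)
  assume no: "\<not> (\<exists>s>0. v s \<le> Some 0 \<and> P (e(i := s)))"
  define R where "R = (\<lambda>e. e i > 0 \<and> \<not> P e)"
  have "definable R" unfolding R_def
    by (rule definable_conj[OF definable_pos[OF polynomial_functions.var] definable_not[OF P]])
  have R: "R (e(i := s)) \<longleftrightarrow> s > 0 \<and> v s \<le> Some 0" for s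
  proof (cases "s > 0 \<and> v s \<le> Some 0")
    case True
    hence "\<not> P (e(i := s))" using no by blast
    thus ?thesis using True by (simp add: R_def)
  next
    case False
    have "P (e(i := s))" if "s > 0"
      by (rule large[OF that]) (use False that in \<open>simp add: not_le\<close>)
    thus ?thesis using False by (auto simp: R_def)
  qed
  obtain g :: 'g where "g \<noteq> 0" using nontriv by blast
  hence "max g (- g) > 0" by (auto simp: less_max_iff_disj neg_less_0_iff_less)
  moreover obtain b where "b > 0" "v b = Some (max g (- g))" using positive_with_val[of "max g (- g)"] by blast
  ultimately have b: "b > 0" "v b > Some 0" by simp_all
  have bound: "a < b'" if "R (e(i := a))" "b' > 0" "v b' > Some 0" for a b'
  proof -
    have "v a < v b'" using that R by (meson le_less_trans)
    thus ?thesis using val_less_imp_abs_less[of a b'] that R by auto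
  qed
  obtain s where s: "\<And>a. R (e(i := a)) \<Longrightarrow> a \<le> s" "\<And>u. (\<And>a. R (e(i := a)) \<Longrightarrow> a \<le> u) \<Longrightarrow> s \<le> u"
  proof (rule definable_supremum[OF \<open>definable R\<close>, of e i 1 b])
    show "R (e(i := 1))" by (simp add: R val_one)
  qed (use bound b in \<open>auto intro: less_imp_le\<close>)
  have "1 \<le> s" by (rule s(1)) (simp add: R val_one)
  show False
  proof (cases "v s \<le> Some 0")
    case True
    have "v (s + 1) \<le> max (v s) (v 1)" by (rule val_add_le)
    hence "v (s + 1) \<le> Some 0" using True val_one by (auto simp: max_def split: if_splits)
    hence "s + 1 \<le> s" using \<open>1 \<le> s\<close> by (intro s(1)) (simp add: R)
    thus False by simp
  next
    case False
    have "v s \<le> max (v (s / 2)) (v (s / 2))" using val_add_le[of "s / 2" "s / 2"] by simp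
    hence "v (s / 2) > Some 0" using False by simp
    hence "s \<le> s / 2" using bound[of _ "s / 2"] \<open>1 \<le> s\<close> by (intro s(2)) (auto intro: less_imp_le)
    thus False using \<open>1 \<le> s\<close> by simp
  qed
qed

text \<open>
  Nearness in the value group is turned into inequalities in the field.
\<close>

lemma close_values:
  assumes c: "c > 0" "v c = Some g" and s: "s > 0" "v s = Some \<epsilon>"
    and x: "Some (g - \<epsilon>) < v x" "v x < Some (g + \<epsilon>)"
  shows "\<bar>x\<bar> \<le> s * c \<and> c \<le> \<bar>s * x\<bar>"
proof -
  have "v x < v (s * c)" using x(2) val_mult_Some[OF s(2) c(2)] by (simp add: add.commute)
  hence "\<bar>x\<bar> < s * c" using val_less_imp_abs_less[of x "s * c"] s c by (simp add: abs_mult)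
  moreover obtain h where h: "v x = Some h" using x(1) by (cases "v x") auto
  have "v c < v (s * x)" using x(1) c h val_mult_Some[OF s(2) h] by (simp add: algebra_simps)
  hence "c < \<bar>s * x\<bar>" using val_less_imp_abs_less[of c "s * x"] c by simp
  ultimately show ?thesis by simp
qed

text \<open>
  The same inequalities with a factor of nonpositive value leave no room between the values of
  \<open>x\<close> and \<open>c\<close>.
\<close>

lemma equal_values:
  assumes c: "c > 0" "v c = Some g" and s: "s > 0" "v s \<le> Some 0"
    and x: "\<bar>x\<bar> \<le> s * c" "c \<le> \<bar>s * x\<bar>"
  shows "v x = Some g"
proof -
  obtain \<epsilon> where \<epsilon>: "v s = Some \<epsilon>" "\<epsilon> \<le> 0" using s val_Some[of s] by auto
  have "x \<noteq> 0" using c x by auto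
  then obtain h where h: "v x = Some h" using val_Some by blast
  have "v x \<le> v (s * c)" using x s c by (intro val_mono) (simp add: abs_mult)
  hence "h \<le> \<epsilon> + g" using h val_mult_Some[OF \<epsilon>(1) c(2)] by simp
  moreover have "v c \<le> v (s * x)" using x c by (intro val_mono) simp
  hence "g \<le> \<epsilon> + h" using c val_mult_Some[OF \<epsilon>(1) h] by simp
  ultimately have "h = g" using \<epsilon>(2) by (metis add_decreasing add.left_neutral add_le_cancel_right order.trans antisym)
  thus ?thesis using h by simp
qed

end

lemma power_topology_closure_box:
  assumes "finite K" "\<gamma> \<in> power_topology K closure_of T" "\<And>k. k \<in> K \<Longrightarrow> open (U k) \<and> \<gamma> k \<in> U k"
  obtains y where "y \<in> T" "\<And>k. k \<in> K \<Longrightarrow> y k \<in> U k"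
proof -
  have g: "\<gamma> \<in> topspace (power_topology K)" "\<And>V. \<gamma> \<in> V \<Longrightarrow> openin (power_topology K) V \<Longrightarrow> \<exists>y\<in>T. y \<in> V"
    using assms(2) unfolding in_closure_of by blast+
  have "openin (power_topology K) (PiE K U)"
    using assms by (simp add: openin_PiE)
  moreover have "\<gamma> \<in> PiE K U" using g(1) assms(3) by (auto simp: topspace_product_topology PiE_def)
  ultimately obtain y where "y \<in> T" "y \<in> PiE K U" using g(2) by blast
  thus ?thesis by (intro that[of y]) auto
qed

lemma closedin_power_topologyI:
  assumes "T \<subseteq> cart_power K" "\<And>\<gamma>. \<gamma> \<in> cart_power K \<Longrightarrow> \<gamma> \<in> power_topology K closure_of T \<Longrightarrow> \<gamma> \<in> T"
  shows "closedin (power_topology K) T"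
proof -
  have "topspace (power_topology K) = (cart_power K :: (nat \<Rightarrow> 'a) set)"
    by (simp add: topspace_product_topology)
  moreover have "power_topology K closure_of T \<subseteq> topspace (power_topology K)" by (rule closure_of_subset_topspace)
  ultimately show ?thesis unfolding closure_of_subset_eq[symmetric] using assms by blast
qed

section \<open>Cluster points of definable families\<close>

text \<open>
  For fixed \<open>t\<close> in the variable \<open>\<tau>\<close>, the predicate describes a nonempty set of points, which
  shrinks as \<open>t\<close> decreases to \<open>0\<close> and is bounded in the coordinate \<open>i\<close>. These sets cluster at
  the limit \<open>c\<close> of the infimum of the coordinate, that is, at the supremum of the \<open>z\<close> that are
  lower bounds of the coordinate for some \<open>t > 0\<close>. The variable \<open>w\<close>, on which \<open>P\<close> does not
  depend, holds \<open>z\<close> when the set of these \<open>z\<close> is written as a definable predicate.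
\<close>

lemma cluster_coordinate:
  fixes P :: "(nat \<Rightarrow> 'k::real_closed_field) \<Rightarrow> bool"
  assumes P: "definable P" and I: "finite I" "i \<in> I" "\<tau> \<notin> I" "w \<notin> I" "w \<noteq> \<tau>"
    and fresh: "\<And>e a. P (e(w := a)) \<longleftrightarrow> P e"
    and mono: "\<And>x t t'. 0 < t \<Longrightarrow> t \<le> t' \<Longrightarrow> P (override_on (e(\<tau> := t)) x I) \<Longrightarrow> P (override_on (e(\<tau> := t')) x I)"
    and ne: "\<And>t. t > 0 \<Longrightarrow> \<exists>x. P (override_on (e(\<tau> := t)) x I)"
    and bdd: "\<And>x t. 0 < t \<Longrightarrow> t \<le> 1 \<Longrightarrow> P (override_on (e(\<tau> := t)) x I) \<Longrightarrow> \<bar>x i\<bar> \<le> M"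
  shows "\<exists>c. \<forall>t>0. \<exists>x. P (override_on (e(\<tau> := t)) x I) \<and> \<bar>x i - c\<bar> \<le> t"
proof -
  define A1 where "A1 = (\<lambda>e. P e \<longrightarrow> e w \<le> e i)"
  define A2 where "A2 = (\<lambda>e. \<not> (\<exists>x. \<not> A1 (override_on e x I)))"
  define A3 where "A3 = (\<lambda>e. e \<tau> > 0 \<and> A2 e)"
  define Q where "Q = (\<lambda>e. \<exists>a. A3 (e(\<tau> := a)))"
  have "definable A1" unfolding A1_def
    by (rule definable_imp[OF P definable_le[OF polynomial_functions.var polynomial_functions.var]])
  hence "definable A2" unfolding A2_def
    by (rule definable_not[OF definable_exists_many[OF I(1) definable_not]])
  hence "definable A3" unfolding A3_def
    by (rule definable_conj[OF definable_pos[OF polynomial_functions.var]])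
  hence Qd: "definable Q" unfolding Q_def by (rule definable_exists)
  have A1: "A1 (override_on (e(w := z, \<tau> := t)) x I) \<longleftrightarrow> (P (override_on (e(\<tau> := t)) x I) \<longrightarrow> z \<le> x i)" for z t x
  proof -
    have "override_on (e(w := z, \<tau> := t)) x I = (override_on (e(\<tau> := t)) x I)(w := z)"
      using I by (auto simp: override_on_def fun_eq_iff)
    hence "P (override_on (e(w := z, \<tau> := t)) x I) \<longleftrightarrow> P (override_on (e(\<tau> := t)) x I)"
      by (simp only: fresh)
    thus ?thesis using I unfolding A1_def by (simp add: override_on_def)
  qed
  have Q: "Q (e(w := z)) \<longleftrightarrow> (\<exists>t>0. \<forall>x. P (override_on (e(\<tau> := t)) x I) \<longrightarrow> z \<le> x i)" for z
    unfolding Q_def A3_def A2_def A1 by simp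
  obtain s where s: "\<And>z. Q (e(w := z)) \<Longrightarrow> z \<le> s" "\<And>u. (\<And>z. Q (e(w := z)) \<Longrightarrow> z \<le> u) \<Longrightarrow> s \<le> u"
  proof (rule definable_supremum[OF Qd, of e w "- M" M])
    show "Q (e(w := - M))" unfolding Q
    proof (intro exI[of _ 1] conjI allI impI)
      show "- M \<le> x i" if "P (override_on (e(\<tau> := 1)) x I)" for x
        using bdd[of 1 x] that by (simp add: abs_le_iff)
    qed simp
    show "z \<le> M" if "Q (e(w := z))" for z
    proof -
      obtain t where t: "t > 0" "\<And>x. P (override_on (e(\<tau> := t)) x I) \<Longrightarrow> z \<le> x i"
        using \<open>Q (e(w := z))\<close> unfolding Q by blast
      have t': "0 < min t 1" "min t 1 \<le> t" "min t 1 \<le> 1" using t by auto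
      obtain x where x: "P (override_on (e(\<tau> := min t 1)) x I)" using ne[OF t'(1)] by blast
      have "z \<le> x i" by (rule t(2)[OF mono[OF t'(1,2) x]])
      also have "\<dots> \<le> M" using bdd[OF t'(1,3) x] by (simp add: abs_le_iff)
      finally show ?thesis .
    qed
  qed blast
  show ?thesis
  proof (intro exI[of _ s] allI impI)
    fix t :: 'k assume t: "0 < t"
    have "\<exists>z. Q (e(w := z)) \<and> s - t < z"
    proof (rule ccontr)
      assume "\<nexists>z. Q (e(w := z)) \<and> s - t < z"
      hence "s \<le> s - t" by (intro s(2)) (auto simp: not_less)
      thus False using t by simp
    qed
    then obtain z t1 where z: "s - t < z" "t1 > 0" "\<And>x. P (override_on (e(\<tau> := t1)) x I) \<Longrightarrow> z \<le> x i"
      unfolding Q by blast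
    define t2 where "t2 = min t t1"
    have t2: "0 < t2" "t2 \<le> t" "t2 \<le> t1" using t z by (auto simp: t2_def)
    have "\<exists>x. P (override_on (e(\<tau> := t2)) x I) \<and> x i < s + t"
    proof (rule ccontr)
      assume "\<nexists>x. P (override_on (e(\<tau> := t2)) x I) \<and> x i < s + t"
      hence "Q (e(w := s + t))" unfolding Q using t2(1) by (intro exI[of _ t2]) (auto simp: not_less)
      hence "s + t \<le> s" by (rule s(1))
      thus False using t by simp
    qed
    then obtain x where x: "P (override_on (e(\<tau> := t2)) x I)" "x i < s + t" by blast
    have "z \<le> x i" by (rule z(3)[OF mono[OF t2(1,3) x(1)]])
    hence "\<bar>x i - s\<bar> \<le> t" using x(2) z(1) by (simp add: abs_le_iff)
    moreover have "P (override_on (e(\<tau> := t)) x I)" by (rule mono[OF t2(1,2) x(1)])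
    ultimately show "\<exists>x. P (override_on (e(\<tau> := t)) x I) \<and> \<bar>x i - s\<bar> \<le> t" by blast
  qed
qed

text \<open>
  The coordinates are treated one after the other: the condition of being within \<open>t\<close> of the
  coordinates found so far is added to \<open>P\<close>, and the resulting family is again decreasing.
\<close>

lemma cluster_point:
  fixes P :: "(nat \<Rightarrow> 'k::real_closed_field) \<Rightarrow> bool"
  assumes P: "definable P" and I: "finite I" "\<tau> \<notin> I" "w \<notin> I" "w \<noteq> \<tau>"
    and fresh: "\<And>e a. P (e(w := a)) \<longleftrightarrow> P e"
    and mono: "\<And>x t t'. 0 < t \<Longrightarrow> t \<le> t' \<Longrightarrow> P (override_on (e(\<tau> := t)) x I) \<Longrightarrow> P (override_on (e(\<tau> := t')) x I)"
    and ne: "\<And>t. t > 0 \<Longrightarrow> \<exists>x. P (override_on (e(\<tau> := t)) x I)"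
    and bdd: "\<And>i x t. i \<in> I \<Longrightarrow> 0 < t \<Longrightarrow> t \<le> 1 \<Longrightarrow> P (override_on (e(\<tau> := t)) x I) \<Longrightarrow> \<bar>x i\<bar> \<le> M i"
  shows "\<exists>c. \<forall>t>0. \<exists>x. P (override_on (e(\<tau> := t)) x I) \<and> (\<forall>i\<in>I. \<bar>x i - c i\<bar> \<le> t)"
proof -
  have "\<exists>c. \<forall>t>0. \<exists>x. P (override_on (e(\<tau> := t)) x I) \<and> (\<forall>i\<in>J. \<bar>x i - c i\<bar> \<le> t)" if "finite J" "J \<subseteq> I" for J
    using that
  proof (induction J)
    case empty
    show ?case using ne by blast
  next
    case (insert j J)
    have "J \<subseteq> I" using insert.prems by simp
    from insert.IH[OF this]
    obtain c where c: "\<forall>t>0. \<exists>x. P (override_on (e(\<tau> := t)) x I) \<and> (\<forall>i\<in>J. \<bar>x i - c i\<bar> \<le> t)"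
      by (elim exE)
    define P' where "P' = (\<lambda>e. P e \<and> (\<forall>k\<in>J. \<bar>e k - c k\<bar> \<le> e \<tau>))"
    have JI: "J \<subseteq> I" "j \<in> I" using insert.prems by auto
    have d: "definable P'" unfolding P'_def
      by (intro definable_conj P definable_ball insert.hyps definable_abs_le polynomial_functions.diff_mem
          polynomial_functions.var polynomial_functions.const_mem)
    have P': "P' (override_on (e(\<tau> := t)) x I) \<longleftrightarrow> P (override_on (e(\<tau> := t)) x I) \<and> (\<forall>k\<in>J. \<bar>x k - c k\<bar> \<le> t)" for t x
    proof -
      have "(override_on (e(\<tau> := t)) x I) k = x k" if "k \<in> J" for k
        using that JI by (auto simp: override_on_def)
      moreover have "(override_on (e(\<tau> := t)) x I) \<tau> = t" using I by (simp add: override_on_def)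
      ultimately show ?thesis unfolding P'_def by simp
    qed
    have "\<exists>d. \<forall>t>0. \<exists>x. P' (override_on (e(\<tau> := t)) x I) \<and> \<bar>x j - d\<bar> \<le> t"
    proof (rule cluster_coordinate[OF d I(1) JI(2) I(2,3,4)])
      show "P' (e(w := a)) \<longleftrightarrow> P' e" for e a
      proof -
        have "(e(w := a)) k = e k" if "k \<in> J" for k using that JI I(3) by auto
        moreover have "(e(w := a)) \<tau> = e \<tau>" using I(4) by simp
        ultimately show ?thesis unfolding P'_def fresh by simp
      qed
      show "P' (override_on (e(\<tau> := t')) x I)" if "0 < t" "t \<le> t'" "P' (override_on (e(\<tau> := t)) x I)" for x t t'
        using that mono[OF that(1,2)] unfolding P' by (meson order.trans)
      show "\<exists>x. P' (override_on (e(\<tau> := t)) x I)" if "t > 0" for t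
        unfolding P' using c that by blast
      show "\<bar>x j\<bar> \<le> M j" if "0 < t" "t \<le> 1" "P' (override_on (e(\<tau> := t)) x I)" for x t
        using that(3) bdd[OF JI(2) that(1,2)] unfolding P' by blast
    qed
    then obtain d where d: "\<And>t. t > 0 \<Longrightarrow> \<exists>x. P' (override_on (e(\<tau> := t)) x I) \<and> \<bar>x j - d\<bar> \<le> t" by blast
    show ?case
    proof (rule exI[of _ "c(j := d)"], intro allI impI)
      fix t :: 'k assume "0 < t"
      then obtain x where x: "P' (override_on (e(\<tau> := t)) x I)" "\<bar>x j - d\<bar> \<le> t" using d by blast
      have "\<bar>x i - (c(j := d)) i\<bar> \<le> t" if "i \<in> insert j J" for i
        using x insert.hyps(2) that unfolding P' by auto
      thus "\<exists>x. P (override_on (e(\<tau> := t)) x I) \<and> (\<forall>i\<in>insert j J. \<bar>x i - (c(j := d)) i\<bar> \<le> t)"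
        using x unfolding P' by blast
    qed
  qed
  from this[OF I(1) order.refl] show ?thesis .
qed

lemma open_contains_interval:
  fixes c :: "'k::{linordered_field, linorder_topology}"
  assumes "open U" "c \<in> U"
  shows "\<exists>d>0. \<forall>y. \<bar>y - c\<bar> \<le> d \<longrightarrow> y \<in> U"
proof -
  obtain b where b: "b > c" "{c..<b} \<subseteq> U" using open_right[OF assms, of "c + 1"] by auto
  obtain a where a: "a < c" "{a<..c} \<subseteq> U" using open_left[OF assms, of "c - 1"] by auto
  define d where "d = min (b - c) (c - a) / 2"
  have d: "0 < d" "d < b - c" "d < c - a" using a b by (auto simp: d_def min_def field_simps)
  have "y \<in> U" if "\<bar>y - c\<bar> \<le> d" for y
  proof (cases "y \<le> c")
    case True
    hence "y \<in> {a<..c}" using that d by (auto simp: abs_le_iff)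
    thus ?thesis using a by blast
  next
    case False
    hence "y \<in> {c..<b}" using that d by (auto simp: abs_le_iff)
    thus ?thesis using b by blast
  qed
  thus ?thesis using d by blast
qed

text \<open>
  In the product of order topologies, the boxes with a common radius \<open>t > 0\<close> form a
  neighbourhood basis.
\<close>

lemma closedin_power_topologyD:
  fixes S :: "(nat \<Rightarrow> 'k::{linordered_field, linorder_topology}) set"
  assumes S: "closedin (power_topology K) S" and K: "finite K" and c: "c \<in> cart_power K"
    and near: "\<And>t. t > 0 \<Longrightarrow> \<exists>x\<in>S. \<forall>i\<in>K. \<bar>x i - c i\<bar> \<le> t"
  shows "c \<in> S"
proof (rule ccontr)
  assume "c \<notin> S"
  have top: "topspace (power_topology K) = (cart_power K :: (nat \<Rightarrow> 'k) set)"
    by (simp add: topspace_product_topology)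
  have SK: "S \<subseteq> cart_power K" using closedin_subset[OF S] top by simp
  have "openin (power_topology K) (cart_power K - S)" using S unfolding closedin_def top by blast
  moreover have "c \<in> cart_power K - S" using c \<open>c \<notin> S\<close> by blast
  ultimately obtain U where U: "\<And>i. i \<in> K \<Longrightarrow> open (U i)" "c \<in> PiE K U" "PiE K U \<subseteq> cart_power K - S"
    unfolding openin_product_topology_alt by (metis open_openin)
  have "\<exists>t>0. \<forall>i\<in>J. \<forall>y. \<bar>y - c i\<bar> \<le> t \<longrightarrow> y \<in> U i" if "finite J" "J \<subseteq> K" for J
    using that
  proof (induction J)
    case empty
    show ?case by (intro exI[of _ 1]) simp
  next
    case (insert j J)
    then obtain t where t: "t > 0" "\<forall>i\<in>J. \<forall>y. \<bar>y - c i\<bar> \<le> t \<longrightarrow> y \<in> U i" by auto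
    have "c j \<in> U j" using U(2) insert.prems by (auto simp: PiE_iff)
    then obtain d where d: "d > 0" "\<forall>y. \<bar>y - c j\<bar> \<le> d \<longrightarrow> y \<in> U j"
      using open_contains_interval[OF U(1)] insert.prems by blast
    show ?case using t d by (intro exI[of _ "min t d"]) auto
  qed
  from this[OF K order.refl] obtain t where t: "t > 0" "\<And>i y. i \<in> K \<Longrightarrow> \<bar>y - c i\<bar> \<le> t \<Longrightarrow> y \<in> U i" by blast
  obtain x where x: "x \<in> S" "\<And>i. i \<in> K \<Longrightarrow> \<bar>x i - c i\<bar> \<le> t" using near[OF t(1)] by blast
  have "x \<in> PiE K U" using x t(2) SK by (auto simp: PiE_iff)
  thus False using U(3) x(1) by blast
qed

section \<open>Images under the valuation\<close>

lemma semialgebraic_subset: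
  assumes "semialgebraic n S" shows "S \<subseteq> cart_power {1..n}"
proof -
  have "B \<subseteq> cart_power {1..n}" if "basic_semialgebraic n B" for B :: "(nat \<Rightarrow> 'k::linordered_field) set"
    using that unfolding basic_semialgebraic_def by (elim exE conjE) (simp only: Collect_subset)
  moreover obtain \<B> where "\<forall>B\<in>\<B>. basic_semialgebraic n B" "S = \<Union>\<B>"
    using assms unfolding semialgebraic_def by (elim exE conjE)
  ultimately show ?thesis by (metis Union_least)
qed

text \<open>
  In the predicate \<open>P\<close> the variable \<open>0\<close> holds \<open>s\<close>, and the variables \<open>1, \<dots>, n\<close> hold the point
  \<open>x\<close>. The inequality \<open>c\<^sub>k / s \<le> |x\<^sub>k|\<close> is written without division.
\<close>

lemma stratum_closed:
  fixes v :: "'k::{real_closed_field, linorder_topology} \<Rightarrow>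
                'g::{linordered_ab_group_add, linorder_topology} option"
  assumes nontriv: "(UNIV :: 'g set) \<noteq> {0}" and v: "convex_valuation v" and S: "semialgebraic n S"
    and K: "K \<subseteq> {1..n}"
  shows "closedin (power_topology K) (stratum n (val_image n v S) K)"
proof (rule closedin_power_topologyI)
  show "stratum n (val_image n v S) K \<subseteq> cart_power K"
    by (auto simp: stratum_def)
  fix \<gamma> :: "nat \<Rightarrow> 'g"
  assume \<gamma>: "\<gamma> \<in> cart_power K" and cl: "\<gamma> \<in> power_topology K closure_of stratum n (val_image n v S) K"
  have finK: "finite K" using K finite_subset by blast
  have "\<forall>k. \<exists>x. x > 0 \<and> v x = Some (\<gamma> k)" using positive_with_val[OF v] by blast
  from choice[OF this] obtain c where c: "\<And>k. c k > 0 \<and> v (c k) = Some (\<gamma> k)" by blast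
  define P where "P = (\<lambda>e. restrict e {1..n} \<in> S \<and>
    (\<forall>k\<in>K. \<bar>e k\<bar> \<le> e 0 * c k \<and> c k \<le> \<bar>e 0 * e k\<bar>) \<and> (\<forall>i\<in>{1..n}-K. e i = 0))"
  define Q where "Q = (\<lambda>e. \<exists>x. P (override_on e x {1..n}))"
  have "definable P" unfolding P_def
    by (intro definable_conj definable_ball semialgebraic_definable[OF S] definable_abs_le definable_le_abs
      definable_zero polynomial_functions.mult_mem polynomial_functions.var polynomial_functions.const_mem finK) auto
  hence Qd: "definable Q" unfolding Q_def by (intro definable_exists_many) auto
  have Q: "Q ((\<lambda>_. 0)(0 := s)) \<longleftrightarrow> (\<exists>x. restrict x {1..n} \<in> S \<and>
    (\<forall>k\<in>K. \<bar>x k\<bar> \<le> s * c k \<and> c k \<le> \<bar>s * x k\<bar>) \<and> (\<forall>i\<in>{1..n}-K. x i = 0))" for s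
  proof -
    have "restrict (override_on ((\<lambda>_. 0)(0 := s)) x {1..n}) {1..n} = restrict x {1..n}" for x :: "nat \<Rightarrow> 'k"
      by (rule restrict_ext) simp
    moreover have "override_on ((\<lambda>_. 0)(0 := s)) x {1..n} 0 = s" for x by simp
    moreover have "override_on ((\<lambda>_. 0)(0 := s)) x {1..n} k = x k" if "k \<in> K" for x k
      using that K by (simp add: override_on_apply_in subset_iff)
    ultimately show ?thesis unfolding Q_def P_def by simp
  qed
  have "Q ((\<lambda>_. 0)(0 := s))" if s: "s > 0" "v s > Some 0" for s
  proof -
    obtain \<epsilon> where \<epsilon>: "v s = Some \<epsilon>" "\<epsilon> > 0" using s(2) by (cases "v s") auto
    obtain y where y: "y \<in> stratum n (val_image n v S) K" "\<And>k. k \<in> K \<Longrightarrow> y k \<in> {\<gamma> k - \<epsilon><..<\<gamma> k + \<epsilon>}"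
      using power_topology_closure_box[OF finK cl, of "\<lambda>k. {\<gamma> k - \<epsilon><..<\<gamma> k + \<epsilon>}"] \<epsilon>(2) by auto
    obtain x where x: "x \<in> S" "support n (\<lambda>k\<in>{1..n}. v (x k)) = K" "y = (\<lambda>k\<in>K. the ((\<lambda>k\<in>{1..n}. v (x k)) k))"
      using y(1) unfolding stratum_def val_image_def by blast
    have xK: "v (x k) = Some (y k)" if "k \<in> K" for k
      using that x K unfolding support_def by auto
    have x0: "x i = 0" if "i \<in> {1..n} - K" for i
      using that x(2) val_eq_None_iff[OF v] unfolding support_def by auto
    have "x \<in> cart_power {1..n}"
      using semialgebraic_subset[OF S] x(1) by (rule subsetD)
    hence "restrict x {1..n} \<in> S" using x(1) by (simp add: PiE_restrict)
    moreover have "\<bar>x k\<bar> \<le> s * c k \<and> c k \<le> \<bar>s * x k\<bar>" if "k \<in> K" for k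
      by (rule close_values[OF v, of _ "\<gamma> k" _ \<epsilon>]) (use c s(1) \<epsilon>(1) y(2)[OF that] xK[OF that] in auto)
    ultimately show ?thesis unfolding Q using x0 by blast
  qed
  then obtain s where s: "s > 0" "v s \<le> Some 0" "Q ((\<lambda>_. 0)(0 := s))"
    using definable_meets_valuation_ring[OF v Qd nontriv, of "\<lambda>_. 0" 0] by blast
  then obtain x where x: "restrict x {1..n} \<in> S" "\<And>k. k \<in> K \<Longrightarrow> \<bar>x k\<bar> \<le> s * c k \<and> c k \<le> \<bar>s * x k\<bar>"
    "\<And>i. i \<in> {1..n} - K \<Longrightarrow> x i = 0" unfolding Q by blast
  have vx: "v (x k) = Some (\<gamma> k)" if "k \<in> K" for k
    using equal_values[OF v _ _ s(1,2)] c x(2)[OF that] by blast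
  have vx0: "v (x i) = None" if "i \<in> {1..n} - K" for i using x(3)[OF that] val_eq_None_iff[OF v] by simp
  define y where "y = (\<lambda>k\<in>{1..n}. v (x k))"
  have "y \<in> val_image n v S" unfolding val_image_def
    by (rule image_eqI[OF _ x(1)]) (auto simp: y_def)
  moreover have "support n y = K" unfolding support_def y_def using vx vx0 K by force
  moreover have "\<gamma> = (\<lambda>k\<in>K. the (y k))"
  proof
    fix k
    show "\<gamma> k = (\<lambda>k\<in>K. the (y k)) k"
    proof (cases "k \<in> K")
      case True
      hence "y k = Some (\<gamma> k)" using K vx unfolding y_def by auto
      thus ?thesis using True by simp
    next
      case False
      thus ?thesis using PiE_arb[OF \<gamma> False] by simp
    qed
  qed
  ultimately show "\<gamma> \<in> stratum n (val_image n v S) K" unfolding stratum_def by blast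
qed

text \<open>
  As for a stratum, with the variable \<open>n + 1\<close> holding a bound \<open>t\<close> for the coordinates outside
  \<open>K\<close> and the condition on \<open>s\<close> quantified over all \<open>t > 0\<close>. The points found for one \<open>s\<close> and all
  \<open>t\<close> cluster at a point \<open>a\<close>, which inherits the inequalities on the coordinates in \<open>K\<close> and
  vanishes in the others.
\<close>

lemma val_image_closed:
  fixes v :: "'k::{real_closed_field, linorder_topology} \<Rightarrow>
                'g::{linordered_ab_group_add, linorder_topology} option"
  assumes nontriv: "(UNIV :: 'g set) \<noteq> {0}" and v: "convex_valuation v" and S: "semialgebraic n S"
    and closed: "closedin (power_topology {1..n}) S"
  shows "closedin (power_topology {1..n}) (val_image n v S)"
proof (rule closedin_power_topologyI)
  show "val_image n v S \<subseteq> cart_power {1..n}"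
    by (auto simp: val_image_def)
  fix \<gamma> :: "nat \<Rightarrow> 'g option"
  assume \<gamma>: "\<gamma> \<in> cart_power {1..n}" and cl: "\<gamma> \<in> power_topology {1..n} closure_of val_image n v S"
  define K where "K = {k \<in> {1..n}. \<gamma> k \<noteq> None}"
  define g where "g = (\<lambda>k. the (\<gamma> k))"
  have K: "K \<subseteq> {1..n}" and finK: "finite K" and gK: "\<And>k. k \<in> K \<Longrightarrow> \<gamma> k = Some (g k)"
    and gN: "\<And>i. i \<in> {1..n} - K \<Longrightarrow> \<gamma> i = None"
    by (auto simp: K_def g_def)
  have "\<forall>k. \<exists>x. x > 0 \<and> v x = Some (g k)" using positive_with_val[OF v] by blast
  from choice[OF this] obtain c where c: "\<And>k. c k > 0 \<and> v (c k) = Some (g k)" by blast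
  define P where "P = (\<lambda>e. restrict e {1..n} \<in> S \<and>
    (\<forall>k\<in>K. \<bar>e k\<bar> \<le> e 0 * c k \<and> c k \<le> \<bar>e 0 * e k\<bar>) \<and> (\<forall>i\<in>{1..n}-K. \<bar>e i\<bar> \<le> e (n + 1)))"
  define Q where "Q = (\<lambda>e. \<not> (\<exists>t. \<not> ((e(n + 1 := t)) (n + 1) > 0 \<longrightarrow> (\<exists>x. P (override_on (e(n + 1 := t)) x {1..n})))))"
  have Pd: "definable P" unfolding P_def
    by (intro definable_conj definable_ball semialgebraic_definable[OF S] definable_abs_le definable_le_abs
      polynomial_functions.mult_mem polynomial_functions.var polynomial_functions.const_mem finK) auto
  have "definable (\<lambda>e. e (n + 1) > 0 \<longrightarrow> (\<exists>x. P (override_on e x {1..n})))"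
    by (intro definable_imp definable_pos polynomial_functions.var definable_exists_many Pd) auto
  hence Qd: "definable Q" unfolding Q_def
    by (rule definable_not[OF definable_exists[OF definable_not]])
  define E where "E = (\<lambda>s t x. override_on ((\<lambda>_::nat. 0::'k)(0 := s, n + 1 := t)) x {1..n})"
  have P: "P (E s t x) \<longleftrightarrow> restrict x {1..n} \<in> S \<and>
    (\<forall>k\<in>K. \<bar>x k\<bar> \<le> s * c k \<and> c k \<le> \<bar>s * x k\<bar>) \<and> (\<forall>i\<in>{1..n}-K. \<bar>x i\<bar> \<le> t)" for s t x
  proof -
    have "restrict (E s t x) {1..n} = restrict x {1..n}"
      unfolding E_def by (rule restrict_ext) simp
    moreover have "E s t x 0 = s" "E s t x (n + 1) = t" by (simp_all add: E_def)
    moreover have "E s t x k = x k" if "k \<in> {1..n}" for k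
      using that by (simp add: E_def)
    moreover have "E s t x k = x k" if "k \<in> K" for k
      using that K by (simp add: E_def override_on_apply_in subset_iff)
    ultimately show ?thesis unfolding P_def by simp
  qed
  have Q: "Q ((\<lambda>_. 0)(0 := s)) \<longleftrightarrow> (\<forall>t>0. \<exists>x. P (E s t x))" for s
    unfolding Q_def E_def by simp
  have "Q ((\<lambda>_. 0)(0 := s))" if s: "s > 0" "v s > Some 0" for s
    unfolding Q
  proof (intro allI impI)
    fix t :: 'k assume "t > 0"
    obtain \<epsilon> where \<epsilon>: "v s = Some \<epsilon>" "\<epsilon> > 0" using s(2) by (cases "v s") auto
    obtain h where h: "v t = Some h" using val_Some[OF v, of t] \<open>t > 0\<close> by auto
    define U where "U = (\<lambda>k. if k \<in> K then {Some (g k - \<epsilon>)<..<Some (g k + \<epsilon>)} else {..<v t})"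
    have "\<And>k. k \<in> {1..n} \<Longrightarrow> open (U k) \<and> \<gamma> k \<in> U k"
      using \<epsilon>(2) gK gN h by (auto simp: U_def)
    then obtain y where y: "y \<in> val_image n v S" "\<And>k. k \<in> {1..n} \<Longrightarrow> y k \<in> U k"
      using power_topology_closure_box[OF _ cl, of U] by auto
    obtain x where x: "x \<in> S" "y = (\<lambda>k\<in>{1..n}. v (x k))" using y(1) unfolding val_image_def by blast
    have "x \<in> cart_power {1..n}"
      using semialgebraic_subset[OF S] x(1) by (rule subsetD)
    hence "restrict x {1..n} \<in> S" using x(1) by (simp add: PiE_restrict)
    moreover have "\<bar>x k\<bar> \<le> s * c k \<and> c k \<le> \<bar>s * x k\<bar>" if k: "k \<in> K" for k
    proof -
      have "v (x k) \<in> {Some (g k - \<epsilon>)<..<Some (g k + \<epsilon>)}"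
        using y(2)[of k] k K by (auto simp: U_def x(2))
      thus ?thesis
        by (intro close_values[OF v, of _ "g k" _ \<epsilon>]) (use c s(1) \<epsilon>(1) in auto)
    qed
    moreover have "\<bar>x i\<bar> \<le> t" if i: "i \<in> {1..n} - K" for i
    proof -
      have "v (x i) < v t" using y(2)[of i] i by (auto simp: U_def x(2))
      thus ?thesis using val_less_imp_abs_less[OF v, of "x i" t] \<open>t > 0\<close> by simp
    qed
    ultimately show "\<exists>x. P (E s t x)" unfolding P by blast
  qed
  then obtain s where s: "s > 0" "v s \<le> Some 0" "Q ((\<lambda>_. 0)(0 := s))"
    using definable_meets_valuation_ring[OF v Qd nontriv, of "\<lambda>_. 0" 0] by blast
  have "\<exists>a. \<forall>t>0. \<exists>x. P (E s t x) \<and> (\<forall>i\<in>{1..n}. \<bar>x i - a i\<bar> \<le> t)"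
    unfolding E_def
  proof (rule cluster_point[OF Pd, where w = "n + 2" and M = "\<lambda>i. if i \<in> K then s * c i else 1"])
    show "P (e(n + 2 := a)) \<longleftrightarrow> P e" for e a
    proof -
      have "restrict (e(n + 2 := a)) {1..n} = restrict e {1..n}" by (rule restrict_ext) simp
      moreover have "(e(n + 2 := a)) k = e k" if "k \<in> K" for k using that K by auto
      moreover have "(e(n + 2 := a)) k = e k" if "k \<in> {1..n} - K" for k using that by auto
      ultimately show ?thesis unfolding P_def by simp
    qed
    note PE = P[unfolded E_def]
    show "P (override_on ((\<lambda>_. 0)(0 := s, n + 1 := t')) x {1..n})"
      if "0 < t" "t \<le> t'" "P (override_on ((\<lambda>_. 0)(0 := s, n + 1 := t)) x {1..n})" for x t t'
      using that unfolding PE by (meson order.trans)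
    show "\<exists>x. P (override_on ((\<lambda>_. 0)(0 := s, n + 1 := t)) x {1..n})" if "0 < t" for t
      using s(3) that unfolding Q E_def by blast
    show "\<bar>x i\<bar> \<le> (if i \<in> K then s * c i else 1)"
      if "i \<in> {1..n}" "0 < t" "t \<le> 1" "P (override_on ((\<lambda>_. 0)(0 := s, n + 1 := t)) x {1..n})" for i x t
      using that unfolding PE by (cases "i \<in> K") (auto intro: order.trans)
  qed auto
  then obtain a where a: "\<And>t. t > 0 \<Longrightarrow> \<exists>x. P (E s t x) \<and> (\<forall>i\<in>{1..n}. \<bar>x i - a i\<bar> \<le> t)" by blast
  have "restrict a {1..n} \<in> S"
  proof (rule closedin_power_topologyD[OF closed])
    show "\<exists>x\<in>S. \<forall>i\<in>{1..n}. \<bar>x i - restrict a {1..n} i\<bar> \<le> t" if t: "t > 0" for t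
    proof -
      obtain x where "P (E s t x)" "\<forall>i\<in>{1..n}. \<bar>x i - a i\<bar> \<le> t" using a[OF t] by blast
      thus ?thesis unfolding P by (intro bexI[of _ "restrict x {1..n}"]) auto
    qed
  qed auto
  moreover have "v (a k) = \<gamma> k" if k: "k \<in> {1..n}" for k
  proof (cases "k \<in> K")
    case True
    have "\<bar>a k\<bar> \<le> s * c k"
    proof (rule field_le_epsilon)
      fix t :: 'k assume "0 < t"
      then obtain x where "P (E s t x)" "\<forall>i\<in>{1..n}. \<bar>x i - a i\<bar> \<le> t" using a by blast
      hence "\<bar>x k\<bar> \<le> s * c k" "\<bar>x k - a k\<bar> \<le> t" using True k unfolding P by auto
      thus "\<bar>a k\<bar> \<le> s * c k + t" by linarith
    qed
    moreover have "c k \<le> \<bar>s * a k\<bar>"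
    proof (rule field_le_epsilon)
      fix t :: 'k assume "0 < t"
      hence "t / s > 0" using s by simp
      then obtain x where "P (E s (t / s) x)" "\<forall>i\<in>{1..n}. \<bar>x i - a i\<bar> \<le> t / s" using a by blast
      hence x: "c k \<le> \<bar>s * x k\<bar>" "\<bar>x k - a k\<bar> \<le> t / s" using True k unfolding P by auto
      have "\<bar>s * x k - s * a k\<bar> = s * \<bar>x k - a k\<bar>"
        using s by (simp add: abs_mult flip: right_diff_distrib)
      also have "\<dots> \<le> t" using x(2) s by (simp add: field_simps)
      finally show "c k \<le> \<bar>s * a k\<bar> + t" using x(1) by linarith
    qed
    ultimately have "v (a k) = Some (g k)"
      using equal_values[OF v _ _ s(1,2)] c by blast
    thus ?thesis using gK True by simp
  next
    case False
    have "\<bar>a k\<bar> \<le> 0"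
    proof (rule field_le_epsilon)
      fix t :: 'k assume "0 < t"
      hence "t / 2 > 0" by simp
      then obtain x where "P (E s (t / 2) x)" "\<forall>i\<in>{1..n}. \<bar>x i - a i\<bar> \<le> t / 2" using a by blast
      hence "\<bar>x k\<bar> \<le> t / 2" "\<bar>x k - a k\<bar> \<le> t / 2" using False k unfolding P by auto
      thus "\<bar>a k\<bar> \<le> 0 + t" using field_sum_of_halves[of t] by linarith
    qed
    hence "v (a k) = None" using val_eq_None_iff[OF v] by simp
    thus ?thesis using gN False k by simp
  qed
  hence "\<gamma> = (\<lambda>k\<in>{1..n}. v (restrict a {1..n} k))"
    using PiE_arb[OF \<gamma>] by (intro ext) simp
  ultimately show "\<gamma> \<in> val_image n v S" unfolding val_image_def by blast
qed

theorem theorem4p1: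
  fixes v :: "'k::{real_closed_field, linorder_topology} \<Rightarrow>
                'g::{linordered_ab_group_add, linorder_topology} option"
    and n :: nat
    and S :: "(nat \<Rightarrow> 'k) set"
  assumes "nontrivial_valuation v"
    and "convex_valuation v"
    and "semialgebraic n S"
  shows "(\<forall>K. K \<subseteq> {1..n} \<and> K \<noteq> {} \<longrightarrow> closedin (power_topology K) (stratum n (val_image n v S) K)) \<and>
         (closedin (power_topology {1..n}) S \<longrightarrow>
           closedin (power_topology {1..n}) (val_image n v S))"
proof -
  have "(UNIV :: 'g set) \<noteq> {0}" using assms(1) by (simp add: nontrivial_valuation_def)
  thus ?thesis using stratum_closed val_image_closed assms(2,3) by blast
qed

end
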